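(* Let $G$ be a finite group or a compact Lie group, let $\{U(g): g\in G\}$ be a unitary representation of $G$ on a Hilbert space $\mathcal{H}$, and let $|\psi\rangle,|\phi\rangle\in\mathcal{H}$ be unit vectors. Then $\psi\xrightarrow{G\text{-cov}}\phi$ if and only if there exists a positive definite function $f:G\to\mathbb{C}$ such that $$\forall g\in G:\quad \chi_\psi(g)=\chi_\phi(g)\,f(g).$$
   Context: Unitary representations of compact Lie groups are (strongly) continuous. The characteristic function of a pure state $\psi$ is $\chi_\psi:G\to\mathbb{C}$, $\chi_\psi(g)=\langle\psi|U(g)|\psi\rangle$. A function $f:G\to\mathbb{C}$ is positive definite if for every $n$, all $g_1,\dots,g_n\in G$ and all $\alpha_1,\dots,\alpha_n\in\mathbb{C}$ one has $\sum_{i,j}\overline{\alpha_i}\,\alpha_j\, f(g_i^{-1}g_j)\ge 0$. A quantum channel is a linear, trace-preserving, completely positive map on operators. A channel $\mathcal{E}$ from operators on $\mathcal{H}$ to operators on $\mathcal{H}$ is $G$-covariant if $\mathcal{E}(U(g)XU^\dagger(g))=U(g)\mathcal{E}(X)U^\dagger(g)$ for all $g\in G$ and all $X$. Write $\psi\xrightarrow{G\text{-cov}}\phi$ if there is a $G$-covariant channel $\mathcal{E}$ with $\mathcal{E}(|\psi\rangle\langle\psi|)=|\phi\rangle\langle\phi|$. *)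

theory Defs
  imports "HOL-Analysis.Analysis" "HOL-Algebra.Group" "HOL-Library.Complex_Order"
begin

section \<open>Complex Hilbert spaces\<close>

text \<open>
  The complex inner product is conjugate-linear in its first argument. Its real part is required
  to be the real inner product of the underlying class, which gives definiteness and makes
  \<open>norm x = sqrt (Re (cinner x x))\<close>. The dimension is arbitrary, finite or infinite.
\<close>

class complex_hilbert_space = real_inner + complete_space +
  fixes scaleC :: "complex \<Rightarrow> 'a \<Rightarrow> 'a"  (infixr \<open>*\<^sub>C\<close> 75)
    and cinner :: "'a \<Rightarrow> 'a \<Rightarrow> complex"
  assumes scaleC_add_right: "c *\<^sub>C (x + y) = c *\<^sub>C x + c *\<^sub>C y"
    and scaleC_add_left: "(c + d) *\<^sub>C x = c *\<^sub>C x + d *\<^sub>C x"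
    and scaleC_scaleC: "c *\<^sub>C d *\<^sub>C x = (c * d) *\<^sub>C x"
    and scaleC_of_real: "complex_of_real r *\<^sub>C x = r *\<^sub>R x"
    and cinner_commute: "cinner x y = cnj (cinner y x)"
    and cinner_add_right: "cinner x (y + z) = cinner x y + cinner x z"
    and cinner_scaleC_right: "cinner x (c *\<^sub>C y) = c * cinner x y"
    and inner_eq_Re_cinner: "inner x y = Re (cinner x y)"

instantiation complex :: complex_hilbert_space
begin
definition scaleC_complex :: "complex \<Rightarrow> complex \<Rightarrow> complex" where "scaleC_complex c x = c * x"
definition cinner_complex :: "complex \<Rightarrow> complex \<Rightarrow> complex" where "cinner_complex x y = cnj x * y"
instance
  by standard
    (auto simp: scaleC_complex_def cinner_complex_def algebra_simps scaleR_conv_of_real inner_complex_def)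
end

instantiation vec :: (complex_hilbert_space, finite) complex_hilbert_space
begin
definition scaleC_vec :: "complex \<Rightarrow> 'a ^ 'b \<Rightarrow> 'a ^ 'b"
  where "scaleC_vec c x = (\<chi> i. c *\<^sub>C x $ i)"
definition cinner_vec :: "'a ^ 'b \<Rightarrow> 'a ^ 'b \<Rightarrow> complex"
  where "cinner_vec x y = (\<Sum>i\<in>UNIV. cinner (x $ i) (y $ i))"
instance
proof
  fix x y :: "'a ^ 'b"
  show "cinner x y = cnj (cinner y x)"
    unfolding cinner_vec_def cnj_sum by (intro sum.cong refl cinner_commute)
qed (simp_all add: scaleC_vec_def cinner_vec_def vec_eq_iff scaleC_add_right scaleC_add_left
      scaleC_scaleC scaleC_of_real cinner_add_right cinner_scaleC_right sum.distrib sum_distrib_left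
      inner_vec_def inner_eq_Re_cinner)
end


section \<open>Operators\<close>

definition clinear_op :: "('h::complex_hilbert_space \<Rightarrow> 'h) \<Rightarrow> bool"
  where "clinear_op A \<longleftrightarrow>
    (\<forall>x y. A (x + y) = A x + A y) \<and> (\<forall>c x. A (c *\<^sub>C x) = c *\<^sub>C A x)"

definition adjoint_op :: "('h::complex_hilbert_space \<Rightarrow> 'h) \<Rightarrow> 'h \<Rightarrow> 'h"
  where "adjoint_op A = (THE B. \<forall>x y. cinner (A x) y = cinner x (B y))"

definition unitary_op :: "('h::complex_hilbert_space \<Rightarrow> 'h) \<Rightarrow> bool"
  where "unitary_op V \<longleftrightarrow>
    clinear_op V \<and> (\<forall>x y. cinner (V x) (V y) = cinner x y) \<and> surj V"

text \<open>The operator \<open>|x\<rangle>\<langle>y|\<close>.\<close>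

definition ket_bra :: "'h::complex_hilbert_space \<Rightarrow> 'h \<Rightarrow> 'h \<Rightarrow> 'h"
  where "ket_bra x y = (\<lambda>v. cinner y v *\<^sub>C x)"

text \<open>
  Trace-class (nuclear) operators: absolutely convergent series of operators
  \<open>|x n\<rangle>\<langle>y n|\<close>. Such operators are automatically bounded and complex linear; on a
  finite-dimensional space they are all the linear operators.
\<close>

definition trace_class :: "('h::complex_hilbert_space \<Rightarrow> 'h) \<Rightarrow> bool"
  where "trace_class T \<longleftrightarrow>
    (\<exists>x y :: nat \<Rightarrow> 'h. summable (\<lambda>n. norm (x n) * norm (y n)) \<and>
       (\<forall>v. (\<lambda>n. ket_bra (x n) (y n) v) sums T v))"

definition orthonormal_basis :: "'h::complex_hilbert_space set \<Rightarrow> bool"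
  where "orthonormal_basis B \<longleftrightarrow>
    (\<forall>e\<in>B. \<forall>e'\<in>B. cinner e e' = (if e = e' then 1 else 0)) \<and>
    (\<forall>x. (\<forall>e\<in>B. cinner e x = 0) \<longrightarrow> x = 0)"

text \<open>For a trace-class operator the sum does not depend on the orthonormal basis.\<close>

definition trace_op :: "('h::complex_hilbert_space \<Rightarrow> 'h) \<Rightarrow> complex"
  where "trace_op T =
    (THE t. \<forall>B. orthonormal_basis B \<longrightarrow> ((\<lambda>e. cinner e (T e)) has_sum t) B)"


section \<open>Quantum channels\<close>

text \<open>
  An \<open>n \<times> n\<close> matrix of operators is an operator on the \<open>n\<close>-fold direct sum of the space with
  itself, that is, on its tensor product with \<open>\<complex>\<^sup>n\<close>; this is positivity of that operator.
\<close>

definition positive_block_op :: "nat \<Rightarrow> (nat \<Rightarrow> nat \<Rightarrow> 'h::complex_hilbert_space \<Rightarrow> 'h) \<Rightarrow> bool"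
  where "positive_block_op n X \<longleftrightarrow>
    (\<forall>v :: nat \<Rightarrow> 'h. 0 \<le> (\<Sum>i<n. \<Sum>j<n. cinner (v i) (X i j (v j))))"

text \<open>
  Channels act on the trace-class operators, so that the trace makes sense in every dimension.
  The behaviour of \<open>\<E>\<close> on other functions is irrelevant.
\<close>

definition completely_positive ::
    "(('h::complex_hilbert_space \<Rightarrow> 'h) \<Rightarrow> ('h \<Rightarrow> 'h)) \<Rightarrow> bool"
  where "completely_positive \<E> \<longleftrightarrow>
    (\<forall>n X. (\<forall>i<n. \<forall>j<n. trace_class (X i j)) \<longrightarrow> positive_block_op n X \<longrightarrow>
       positive_block_op n (\<lambda>i j. \<E> (X i j)))"

definition quantum_channel ::
    "(('h::complex_hilbert_space \<Rightarrow> 'h) \<Rightarrow> ('h \<Rightarrow> 'h)) \<Rightarrow> bool"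
  where "quantum_channel \<E> \<longleftrightarrow>
    (\<forall>X. trace_class X \<longrightarrow> trace_class (\<E> X)) \<and>
    (\<forall>X Y. trace_class X \<longrightarrow> trace_class Y \<longrightarrow> \<E> (\<lambda>v. X v + Y v) = (\<lambda>v. \<E> X v + \<E> Y v)) \<and>
    (\<forall>c X. trace_class X \<longrightarrow> \<E> (\<lambda>v. c *\<^sub>C X v) = (\<lambda>v. c *\<^sub>C \<E> X v)) \<and>
    (\<forall>X. trace_class X \<longrightarrow> trace_op (\<E> X) = trace_op X) \<and>
    completely_positive \<E>"


section \<open>Representations and covariance\<close>

definition unitary_rep ::
    "('g, 'm) monoid_scheme \<Rightarrow> ('g \<Rightarrow> 'h::complex_hilbert_space \<Rightarrow> 'h) \<Rightarrow> bool"
  where "unitary_rep G U \<longleftrightarrow>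
    (\<forall>g\<in>carrier G. unitary_op (U g)) \<and>
    (\<forall>g\<in>carrier G. \<forall>h\<in>carrier G. U (g \<otimes>\<^bsub>G\<^esub> h) = U g \<circ> U h)"

definition strongly_continuous_rep ::
    "'g topology \<Rightarrow> ('g \<Rightarrow> 'h::complex_hilbert_space \<Rightarrow> 'h) \<Rightarrow> bool"
  where "strongly_continuous_rep T U \<longleftrightarrow> (\<forall>x. continuous_map T euclidean (\<lambda>g. U g x))"

definition covariant ::
    "('g, 'm) monoid_scheme \<Rightarrow> ('g \<Rightarrow> 'h::complex_hilbert_space \<Rightarrow> 'h) \<Rightarrow>
     (('h \<Rightarrow> 'h) \<Rightarrow> ('h \<Rightarrow> 'h)) \<Rightarrow> bool"
  where "covariant G U \<E> \<longleftrightarrow>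
    (\<forall>g\<in>carrier G. \<forall>X. trace_class X \<longrightarrow>
       \<E> (U g \<circ> X \<circ> adjoint_op (U g)) = U g \<circ> \<E> X \<circ> adjoint_op (U g))"

definition cov_convertible ::
    "('g, 'm) monoid_scheme \<Rightarrow> ('g \<Rightarrow> 'h::complex_hilbert_space \<Rightarrow> 'h) \<Rightarrow> 'h \<Rightarrow> 'h \<Rightarrow> bool"
  where "cov_convertible G U \<psi> \<phi> \<longleftrightarrow>
    (\<exists>\<E>. quantum_channel \<E> \<and> covariant G U \<E> \<and> \<E> (ket_bra \<psi> \<psi>) = ket_bra \<phi> \<phi>)"

definition characteristic_function ::
    "('g \<Rightarrow> 'h::complex_hilbert_space \<Rightarrow> 'h) \<Rightarrow> 'h \<Rightarrow> 'g \<Rightarrow> complex"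
  where "characteristic_function U \<psi> g = cinner \<psi> (U g \<psi>)"

definition positive_definite :: "('g, 'm) monoid_scheme \<Rightarrow> ('g \<Rightarrow> complex) \<Rightarrow> bool"
  where "positive_definite G f \<longleftrightarrow>
    (\<forall>n. \<forall>g :: nat \<Rightarrow> 'g. \<forall>\<alpha> :: nat \<Rightarrow> complex. (\<forall>i<n. g i \<in> carrier G) \<longrightarrow>
       0 \<le> (\<Sum>i<n. \<Sum>j<n. cnj (\<alpha> i) * \<alpha> j * f (inv\<^bsub>G\<^esub> (g i) \<otimes>\<^bsub>G\<^esub> g j)))"


section \<open>Compact Lie groups\<close>

text \<open>\<open>C\<^sup>k\<close> and \<open>C\<^sup>\<infinity>\<close> maps on an open set \<open>S\<close>.\<close>

primrec Ck_on :: "nat \<Rightarrow> 'a::euclidean_space set \<Rightarrow> ('a \<Rightarrow> 'b::euclidean_space) \<Rightarrow> bool"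
  where
    "Ck_on 0 S f \<longleftrightarrow> continuous_on S f"
  | "Ck_on (Suc k) S f \<longleftrightarrow> (\<forall>x\<in>S. f differentiable (at x)) \<and>
       (\<forall>v. Ck_on k S (\<lambda>x. frechet_derivative f (at x) v))"

definition smooth_on :: "'a::euclidean_space set \<Rightarrow> ('a \<Rightarrow> 'b::euclidean_space) \<Rightarrow> bool"
  where "smooth_on S f \<longleftrightarrow> (\<forall>k. Ck_on k S f)"

text \<open>A chart is a pair of its domain and its coordinate map.\<close>

type_synonym ('g, 'e) chart = "'g set \<times> ('g \<Rightarrow> 'e)"

definition chart_on :: "'g topology \<Rightarrow> ('g, 'e::euclidean_space) chart \<Rightarrow> bool"
  where "chart_on T = (\<lambda>(D, c). openin T D \<and> open (c ` D) \<and>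
    homeomorphic_map (subtopology T D) (top_of_set (c ` D)) c)"

definition smooth_atlas :: "'g topology \<Rightarrow> ('g, 'e::euclidean_space) chart set \<Rightarrow> bool"
  where "smooth_atlas T \<A> \<longleftrightarrow>
    (\<forall>\<kappa>\<in>\<A>. chart_on T \<kappa>) \<and> (\<Union>(D, c)\<in>\<A>. D) = topspace T \<and>
    (\<forall>(D1, c1)\<in>\<A>. \<forall>(D2, c2)\<in>\<A>. smooth_on (c1 ` (D1 \<inter> D2)) (c2 \<circ> inv_into D1 c1))"

text \<open>
  The dimension of the group is that of \<open>'e\<close>, hence positive; a compact Lie group of dimension
  zero is a finite group with the discrete topology.
\<close>

definition compact_Lie_group ::
    "('g, 'm) monoid_scheme \<Rightarrow> 'g topology \<Rightarrow> ('g, 'e::euclidean_space) chart set \<Rightarrow> bool"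
  where "compact_Lie_group G T \<A> \<longleftrightarrow>
    group G \<and> topspace T = carrier G \<and>
    compact_space T \<and> Hausdorff_space T \<and> second_countable T \<and> smooth_atlas T \<A> \<and>
    continuous_map (prod_topology T T) T (\<lambda>(g, h). g \<otimes>\<^bsub>G\<^esub> h) \<and>
    continuous_map T T (\<lambda>g. inv\<^bsub>G\<^esub> g) \<and>
    (\<forall>(D1, c1)\<in>\<A>. \<forall>(D2, c2)\<in>\<A>. \<forall>(D3, c3)\<in>\<A>.
       smooth_on ((\<lambda>(g, h). (c1 g, c2 h)) ` {(g, h) \<in> D1 \<times> D2. g \<otimes>\<^bsub>G\<^esub> h \<in> D3})
         (\<lambda>(a, b). c3 (inv_into D1 c1 a \<otimes>\<^bsub>G\<^esub> inv_into D2 c2 b))) \<and>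
    (\<forall>(D1, c1)\<in>\<A>. \<forall>(D2, c2)\<in>\<A>.
       smooth_on (c1 ` {g \<in> D1. inv\<^bsub>G\<^esub> g \<in> D2}) (\<lambda>a. c2 (inv\<^bsub>G\<^esub> (inv_into D1 c1 a))))"

end

theory Submission
  imports Defs
begin

text \<open>
  Given a covariant channel \<open>\<E>\<close> taking \<open>\<psi>\<close> to \<open>\<phi>\<close>, complete positivity makes the operators
  \<open>\<E>(|U(g)\<psi>\<rangle>\<langle>U(h)\<psi>|)\<close> a positive kernel with rank-one diagonal \<open>|U(g)\<phi>\<rangle>\<langle>U(g)\<phi>|\<close>. By
  Cauchy--Schwarz its entries are \<open>c(g,h) |U(g)\<phi>\<rangle>\<langle>U(h)\<phi>|\<close>; covariance makes \<open>c(g,h)\<close> a function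
  \<open>f\<close> of \<open>h\<^sup>-\<^sup>1g\<close>, positivity of the kernel is positive definiteness of \<open>f\<close>, and taking traces gives
  \<open>\<chi>\<^sub>\<psi> = \<chi>\<^sub>\<phi> f\<close>.

  Conversely, the Cholesky algorithm with a dense sequence of pivots splits the kernel of \<open>f\<close> as
  \<open>f(g\<^sup>-\<^sup>1h) = \<Sum>\<^sub>k cnj (c\<^sub>k(g)) c\<^sub>k(h)\<close>. Because of \<open>\<chi>\<^sub>\<psi> = \<chi>\<^sub>\<phi> f\<close>, the assignment
  \<open>U(g)\<psi> \<mapsto> (c\<^sub>k(g) U(g)\<phi>)\<^sub>k\<close> is isometric; it extends to the closed span of the orbit of \<open>\<psi>\<close>,
  and together with the projection onto the orthogonal complement it gives the Kraus operators of a
  covariant channel. No Haar measure and no GNS representation is needed.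
\<close>

section \<open>Complex Hilbert spaces\<close>

text \<open>The Kraus operators built here need not be covariant one by one: the pivots, and with
  them the coefficients \<open>c k\<close>, bear no relation to the group action. The image of
  |U(g)\<psi>><U(h)\<psi>| depends on them only through f(h^-1 g), which is invariant under left
  translation of both g and h, and this makes their sum covariant. The assignment is isometric
  because the images of U(g)\<psi> and U(h)\<psi> have inner product f(g^-1 h) \<chi>_\<phi>(g^-1 h)
  = \<chi>_\<psi>(g^-1 h). The space may have infinite dimension. Identities are therefore checked
  on rank-one operators over a total set of vectors and carried to trace-class operators by
  absolutely convergent double series. Countably many pivots suffice as soon as they are dense for
  the squared distance 2 - 2 Re f(g^-1 h), which is |v_g - v_h|^2 if f(g^-1 h) is read as an inner
  product of vectors v_g and v_h.\<close>

instance complex_hilbert_space \<subseteq> banach ..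

lemma scaleC_zero_left [simp]: "0 *\<^sub>C (x::'h::complex_hilbert_space) = 0"
  using scaleC_of_real[of 0 x] by simp

lemma scaleC_one [simp]: "1 *\<^sub>C (x::'h::complex_hilbert_space) = x"
  using scaleC_of_real[of 1 x] by simp

lemma scaleC_minus_one: "(-1) *\<^sub>C (x::'h::complex_hilbert_space) = - x"
  using scaleC_of_real[of "-1" x] by simp

lemma cinner_scaleC_left:
  "cinner (c *\<^sub>C x) (y::'h::complex_hilbert_space) = cnj c * cinner x y"
  by (metis cinner_commute cinner_scaleC_right complex_cnj_mult)

lemma cinner_add_left:
  "cinner (x + y) (z::'h::complex_hilbert_space) = cinner x z + cinner y z"
  by (metis cinner_add_right cinner_commute complex_cnj_add)

lemma cinner_self: "cinner x x = complex_of_real ((norm (x::'h::complex_hilbert_space))\<^sup>2)"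
  using cinner_commute[of x x] inner_eq_Re_cinner[of x x]
  by (simp add: complex_eq_iff dot_square_norm)

lemma norm_scaleC: "norm (c *\<^sub>C (x::'h::complex_hilbert_space)) = cmod c * norm x"
proof -
  have "complex_of_real ((norm (c *\<^sub>C x))\<^sup>2) = cnj c * (c * complex_of_real ((norm x)\<^sup>2))"
    by (simp only: cinner_self[symmetric] cinner_scaleC_left cinner_scaleC_right mult.left_commute)
  also have "\<dots> = complex_of_real ((cmod c * norm x)\<^sup>2)"
    by (simp only: mult.assoc[symmetric] mult.commute[of "cnj c"] complex_norm_square[symmetric]
        of_real_mult power_mult_distrib of_real_power)
  finally have "(norm (c *\<^sub>C x))\<^sup>2 = (cmod c * norm x)\<^sup>2"
    using of_real_eq_iff by blast
  then show ?thesis by simp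
qed

text \<open>A phase on \<open>y\<close> makes the inner product real and nonnegative, which reduces
  the claim to the real Cauchy-Schwarz inequality.\<close>

lemma norm_cinner_le: "cmod (cinner x y) \<le> norm x * norm (y::'h::complex_hilbert_space)"
proof -
  define c where "c = cnj (sgn (cinner x y))"
  have "c * cinner x y = complex_of_real (cmod (cinner x y))"
    using complex_norm_square[of "cinner x y"] unfolding c_def sgn_div_norm
    by (cases "cinner x y = 0") (simp_all add: scaleR_conv_of_real field_simps power2_eq_square)
  then have "cmod (cinner x y) = inner x (c *\<^sub>C y)"
    by (simp add: inner_eq_Re_cinner cinner_scaleC_right)
  also have "\<dots> \<le> norm x * norm (c *\<^sub>C y)"
    by (rule norm_cauchy_schwarz)
  also have "\<dots> \<le> norm x * norm y"
    unfolding norm_scaleC c_def by (simp add: norm_sgn mult_left_mono)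
  finally show ?thesis .
qed

text \<open>Conjugate linearity in the first argument is linearity over the reals, so the theory of
  bounded bilinear maps supplies limits, sums and series.\<close>

interpretation cinner: bounded_bilinear "cinner :: 'h::complex_hilbert_space \<Rightarrow> 'h \<Rightarrow> complex"
proof
  fix a a' b b' :: 'h and r :: real
  show "cinner (a + a') b = cinner a b + cinner a' b" "cinner a (b + b') = cinner a b + cinner a b'"
    by (rule cinner_add_left cinner_add_right)+
  show "cinner (r *\<^sub>R a) b = r *\<^sub>R cinner a b" "cinner a (r *\<^sub>R b) = r *\<^sub>R cinner a b"
    using cinner_scaleC_left[of "complex_of_real r" a b] cinner_scaleC_right[of a "complex_of_real r" b]
    by (simp_all add: scaleC_of_real scaleR_conv_of_real)
  show "\<exists>K. \<forall>a b. cmod (cinner a (b::'h)) \<le> norm a * norm b * K"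
    using norm_cinner_le by (intro exI[of _ 1]) auto
qed

interpretation scaleC: bounded_bilinear
  "scaleC :: complex \<Rightarrow> 'h::complex_hilbert_space \<Rightarrow> 'h"
proof
  fix a a' :: complex and b b' :: 'h and r :: real
  show "(a + a') *\<^sub>C b = a *\<^sub>C b + a' *\<^sub>C b" "a *\<^sub>C (b + b') = a *\<^sub>C b + a *\<^sub>C b'"
    by (rule scaleC_add_left scaleC_add_right)+
  show "(r *\<^sub>R a) *\<^sub>C b = r *\<^sub>R a *\<^sub>C b" "a *\<^sub>C r *\<^sub>R b = r *\<^sub>R a *\<^sub>C b"
    by (simp_all add: scaleC_of_real[symmetric, where 'a='h] scaleC_scaleC scaleR_conv_of_real mult.commute)
  show "\<exists>K. \<forall>a b. norm (a *\<^sub>C (b::'h)) \<le> norm a * norm b * K"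
    by (intro exI[of _ 1]) (simp add: norm_scaleC)
qed

lemma norm_sq_diff_cinner:
  "(norm (x - y::'h::complex_hilbert_space))\<^sup>2 = (norm x)\<^sup>2 - 2 * Re (cinner y x) + (norm y)\<^sup>2"
  by (simp add: power2_norm_eq_inner inner_diff inner_commute inner_eq_Re_cinner[symmetric])

lemma parallelogram:
  "(norm (x + y::'h::real_inner))\<^sup>2 + (norm (x - y))\<^sup>2 = 2 * (norm x)\<^sup>2 + 2 * (norm y)\<^sup>2"
  by (simp add: power2_norm_eq_inner inner_add inner_diff inner_commute)

lemma eq_if_cinner_eq:
  assumes "\<And>w. cinner w x = cinner w (y::'h::complex_hilbert_space)"
  shows "x = y"
proof -
  have "cinner (x - y) (x - y) = 0"
    using assms by (simp add: cinner.diff_right)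
  then show ?thesis by (simp add: cinner_self)
qed


subsection \<open>Projection, density and the Riesz representation\<close>

definition csubspace :: "'h::complex_hilbert_space set \<Rightarrow> bool"
  where "csubspace D \<longleftrightarrow> 0 \<in> D \<and> (\<forall>x\<in>D. \<forall>y\<in>D. x + y \<in> D) \<and> (\<forall>c. \<forall>x\<in>D. c *\<^sub>C x \<in> D)"

definition ortho :: "'h::complex_hilbert_space set \<Rightarrow> 'h set"
  where "ortho P = {y. \<forall>z\<in>P. cinner z y = 0}"

text \<open>\<open>D\<close> is not assumed closed, so the minimizer of the distance is found only
  in its closure, as the limit of a minimizing sequence.\<close>

lemma nearest_point:
  fixes x :: "'h::complex_hilbert_space"
  assumes D: "csubspace D"
  shows "\<exists>m\<in>closure D. \<forall>z\<in>D. cinner z (x - m) = 0"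
proof -
  have ne: "D \<noteq> {}" and add: "\<And>a b. a \<in> D \<Longrightarrow> b \<in> D \<Longrightarrow> a + b \<in> D"
    and scale: "\<And>c a. a \<in> D \<Longrightarrow> c *\<^sub>C a \<in> D"
    using D by (auto simp: csubspace_def)
  define d where "d = (INF z\<in>D. (norm (x - z))\<^sup>2)"
  have bdd: "bdd_below ((\<lambda>z. (norm (x - z))\<^sup>2) ` D)"
    by (intro bdd_belowI[of _ 0]) auto
  have dle: "d \<le> (norm (x - z))\<^sup>2" if "z \<in> D" for z
    unfolding d_def by (rule cINF_lower[OF bdd that])
  define u where "u = (\<lambda>n. inverse (real (Suc n)))"
  have u0: "u n > 0" and umono: "n \<le> m \<Longrightarrow> u m \<le> u n" for n m
    by (auto simp: u_def intro!: le_imp_inverse_le)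
  have "\<exists>z\<in>D. (norm (x - z))\<^sup>2 < d + u n" for n
    using cINF_less_iff[OF ne bdd, of "d + u n"] u0[of n] by (auto simp: d_def)
  then obtain z where zD: "\<And>n. z n \<in> D" and zd: "\<And>n. (norm (x - z n))\<^sup>2 < d + u n"
    by metis
  \<comment> \<open>The midpoint of \<open>z n\<close> and \<open>z m\<close> lies in
    \<open>D\<close>, so its squared distance from \<open>x\<close> is at least \<open>d\<close>;
    the parallelogram law bounds what is left.\<close>
  have close: "(norm (z n - z m))\<^sup>2 \<le> 2 * u n + 2 * u m" for n m
  proof -
    have "(1/2::complex) *\<^sub>C (z n + z m) \<in> D"
      by (intro scale add zD)
    from dle[OF this] have "4 * d \<le> (2 * norm (x - (1/2::complex) *\<^sub>C (z n + z m)))\<^sup>2"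
      by (simp add: power_mult_distrib)
    also have "2 * norm (x - (1/2::complex) *\<^sub>C (z n + z m)) =
        norm ((2::complex) *\<^sub>C (x - (1/2::complex) *\<^sub>C (z n + z m)))"
      by (simp add: norm_scaleC)
    also have "(2::complex) *\<^sub>C (x - (1/2::complex) *\<^sub>C (z n + z m)) = (x - z n) + (x - z m)"
      using scaleC_add_left[of 1 1 x] by (simp add: scaleC.diff_right scaleC_scaleC)
    finally have "4 * d + (norm (z n - z m))\<^sup>2
        \<le> (norm ((x - z n) + (x - z m)))\<^sup>2 + (norm ((x - z n) - (x - z m)))\<^sup>2"
      by (simp add: norm_minus_commute)
    also have "\<dots> = 2 * (norm (x - z n))\<^sup>2 + 2 * (norm (x - z m))\<^sup>2"
      by (rule parallelogram)
    also have "\<dots> \<le> 2 * (d + u n) + 2 * (d + u m)"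
      by (intro add_mono mult_left_mono less_imp_le zd) simp_all
    finally show ?thesis by simp
  qed
  have "Cauchy z"
  proof (rule metric_CauchyI)
    fix e :: real assume e: "e > 0"
    then obtain N where N: "u N < e\<^sup>2 / 4"
      using reals_Archimedean[of "e\<^sup>2/4"] by (auto simp: u_def)
    have "dist (z m) (z n) < e" if "m \<ge> N" "n \<ge> N" for m n
    proof -
      have "(norm (z m - z n))\<^sup>2 < e\<^sup>2"
        using close[of m n] N umono[OF that(1)] umono[OF that(2)] by linarith
      then show ?thesis
        using e by (simp add: dist_norm power2_less_imp_less)
    qed
    then show "\<exists>M. \<forall>m\<ge>M. \<forall>n\<ge>M. dist (z m) (z n) < e" by blast
  qed
  then obtain m where m: "z \<longlonglongrightarrow> m"
    using convergent_eq_Cauchy by blast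
  have mcl: "m \<in> closure D"
    using zD m by (auto simp: closure_sequential)
  have mle: "(norm (x - m))\<^sup>2 \<le> d"
  proof (rule LIMSEQ_le)
    show "(\<lambda>n. (norm (x - z n))\<^sup>2) \<longlonglongrightarrow> (norm (x - m))\<^sup>2"
      by (intro tendsto_intros m)
    show "(\<lambda>n. d + u n) \<longlonglongrightarrow> d"
      using tendsto_add[OF tendsto_const LIMSEQ_inverse_real_of_nat, of d] by (simp add: u_def)
    show "\<exists>N. \<forall>n\<ge>N. (norm (x - z n))\<^sup>2 \<le> d + u n"
      by (intro exI[of _ 0] allI impI less_imp_le zd)
  qed
  have "cinner y (x - m) = 0" if y: "y \<in> D" for y
  proof (cases "y = 0")
    case False
    define a where "a = cinner y (x - m)"
    define N where "N = (norm y)\<^sup>2"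
    \<comment> \<open>Subtracting the component of \<open>x - m\<close> along \<open>y\<close>
      lowers the squared distance by |a|^2 / N. As \<open>m\<close> may lie outside
      \<open>D\<close>, the lower bound \<open>d\<close> reaches it through the points
      \<open>z n + c *\<^sub>C y\<close>.\<close>
    define c where "c = a / complex_of_real N"
    have N: "N > 0" using False by (simp add: N_def)
    have dlow: "d \<le> (norm ((x - m) - c *\<^sub>C y))\<^sup>2"
    proof (rule LIMSEQ_le_const)
      show "(\<lambda>n. (norm (x - (z n + c *\<^sub>C y)))\<^sup>2) \<longlonglongrightarrow> (norm ((x - m) - c *\<^sub>C y))\<^sup>2"
        unfolding diff_diff_eq by (intro tendsto_intros m)
      show "\<exists>N. \<forall>n\<ge>N. d \<le> (norm (x - (z n + c *\<^sub>C y)))\<^sup>2"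
        by (intro exI[of _ 0] allI impI dle add scale zD y)
    qed
    have "d \<le> (norm (x - m))\<^sup>2 - 2 * Re (cnj c * a) + (cmod c)\<^sup>2 * (norm y)\<^sup>2"
      using dlow
      by (simp add: norm_sq_diff_cinner[of "x - m"] cinner_scaleC_left norm_scaleC power_mult_distrib a_def)
    moreover have "cnj c * a = complex_of_real ((cmod a)\<^sup>2 / N)"
      unfolding c_def of_real_divide complex_norm_square by (simp add: mult.commute[of a])
    moreover have "(cmod c)\<^sup>2 * N = (cmod a)\<^sup>2 / N"
      using N by (simp add: c_def norm_divide power_divide power2_eq_square)
    ultimately have "(cmod a)\<^sup>2 / N \<le> 0"
      using mle by (simp add: N_def)
    then show ?thesis
      using N by (simp add: a_def divide_le_0_iff)
  qed (simp add: cinner.zero_left)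
  then show ?thesis using mcl by blast
qed

lemma closure_UNIV_if_ortho_trivial:
  assumes "csubspace D" and "ortho D \<subseteq> {0}"
  shows "closure D = UNIV"
proof -
  have "x \<in> closure D" for x
  proof -
    obtain m where "m \<in> closure D" "\<forall>z\<in>D. cinner z (x - m) = 0"
      using nearest_point[OF assms(1)] by blast
    moreover from this have "x - m = 0"
      using assms(2) by (auto simp: ortho_def)
    ultimately show ?thesis by simp
  qed
  then show ?thesis by blast
qed

text \<open>The part \<open>d\<close> of \<open>x0\<close> orthogonal to the kernel represents
  \<open>L\<close> after rescaling, since v - (L v / L d) d lies in the kernel for every v.\<close>

lemma riesz:
  fixes L :: "'h::complex_hilbert_space \<Rightarrow> complex"
  assumes L: "bounded_linear L" and Lc: "\<And>c x. L (c *\<^sub>C x) = c * L x"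
  shows "\<exists>r. \<forall>x. L x = cinner r x"
proof (cases "\<forall>x. L x = 0")
  case True
  then show ?thesis by (intro exI[of _ 0]) (simp add: cinner.zero_left)
next
  case False
  then obtain x0 where x0: "L x0 \<noteq> 0" by blast
  interpret L: bounded_linear L by fact
  define N where "N = {x. L x = 0}"
  have "csubspace N"
    by (auto simp: csubspace_def N_def L.zero L.add Lc)
  then obtain m where m: "m \<in> closure N" "\<forall>z\<in>N. cinner z (x0 - m) = 0"
    using nearest_point by blast
  have "closed N"
    unfolding N_def by (intro closed_Collect_eq L.continuous_on continuous_on_id continuous_on_const)
  with m have "L m = 0" by (simp add: N_def)
  define d where "d = x0 - m"
  have Ld: "L d = L x0" using \<open>L m = 0\<close> by (simp add: d_def L.diff)
  then have "d \<noteq> 0" using x0 L.zero by auto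
  have key: "cinner d v = L v / L d * complex_of_real ((norm d)\<^sup>2)" for v
  proof -
    have "v - (L v / L d) *\<^sub>C d \<in> N"
      using Ld x0 by (simp add: N_def L.diff Lc)
    then have "cinner (v - (L v / L d) *\<^sub>C d) d = 0"
      using m by (simp add: d_def)
    then have "cinner d (v - (L v / L d) *\<^sub>C d) = 0"
      by (metis cinner_commute complex_cnj_zero)
    then show ?thesis
      by (simp add: cinner.diff_right cinner_scaleC_right cinner_self)
  qed
  have "L v = cinner (cnj (L d / complex_of_real ((norm d)\<^sup>2)) *\<^sub>C d) v" for v
    using x0 Ld \<open>d \<noteq> 0\<close> by (simp add: cinner_scaleC_left key)
  then show ?thesis by blast
qed

text \<open>The representing vector is orthogonal to \<open>P\<close>. Totality is expressed by a
  trivial orthogonal complement, so that no span or closure of \<open>P\<close> has to be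
  formed.\<close>

lemma functional_zero_if_zero_on_total:
  assumes "bounded_linear L" and "\<And>c x. L (c *\<^sub>C x) = c * L (x::'h::complex_hilbert_space)"
    and "\<And>p. p \<in> P \<Longrightarrow> L p = 0" and "ortho P \<subseteq> {0}"
  shows "L x = 0"
proof -
  obtain r where r: "\<And>x. L x = cinner r x"
    using riesz[OF assms(1,2)] by blast
  then have "cinner p r = 0" if "p \<in> P" for p
    using assms(3)[OF that] cinner_commute[of p r] by simp
  then have "r = 0"
    using assms(4) by (auto simp: ortho_def)
  then show ?thesis by (simp add: r cinner.zero_left)
qed


subsection \<open>Bounded operators and adjoints\<close>

lemma clinear_opD:
  assumes "clinear_op A"
  shows "A (x + y) = A x + A y" "A (c *\<^sub>C x) = c *\<^sub>C A x" "A 0 = 0" "A (x - y) = A x - A y"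
    "A (- x) = - A x"
proof -
  show add: "A (x + y) = A x + A y" and scale: "A (c *\<^sub>C x) = c *\<^sub>C A x" for x y c
    using assms by (auto simp: clinear_op_def)
  show "A 0 = 0" using scale[of 0 0] by simp
  show min: "A (- x) = - A x" for x
    using scale[of "-1" x] by (simp add: scaleC_minus_one)
  show "A (x - y) = A x - A y" using add[of x "- y"] by (simp add: min)
qed

lemma clinear_op_bounded_linear:
  assumes A: "clinear_op A" and bd: "\<And>x. norm (A x) \<le> norm x * C"
  shows "bounded_linear A"
proof (rule bounded_linear_intro)
  show "A (r *\<^sub>R x) = r *\<^sub>R A x" for r x
    by (simp only: scaleC_of_real[symmetric] clinear_opD[OF A])
qed (use bd clinear_opD[OF A] in auto)

lemma adjoint_op_eqI:
  assumes "\<And>x y. cinner (A x) y = cinner x (B y)"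
  shows "adjoint_op A = B"
  unfolding adjoint_op_def
proof (rule the_equality)
  show "C = B" if "\<forall>x y. cinner (A x) y = cinner x (C y)" for C
    by (rule ext, rule eq_if_cinner_eq) (simp add: that[rule_format, symmetric] assms)
qed (use assms in blast)

lemma cinner_adjoint_op:
  fixes A :: "'h::complex_hilbert_space \<Rightarrow> 'h"
  assumes "bounded_linear A" and A: "clinear_op A"
  shows "cinner (A x) y = cinner x (adjoint_op A y)"
proof -
  have "\<exists>r. \<forall>x. cinner y (A x) = cinner r x" for y
    by (rule riesz[OF bounded_linear_compose[OF cinner.bounded_linear_right assms(1)]])
      (simp add: clinear_opD[OF A] cinner_scaleC_right)
  then obtain B where "\<And>x y. cinner y (A x) = cinner (B y) x"
    by metis
  then have "cinner (A x) y = cinner x (B y)" for x y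
    by (metis cinner_commute)
  then show ?thesis
    using adjoint_op_eqI[of A B] by simp
qed


subsection \<open>Orthonormal bases\<close>

text \<open>\<open>trace_op\<close> is a definite description quantified over all bases; without a
  basis every number would satisfy it.\<close>

lemma ex_orthonormal_basis: "\<exists>B::'h::complex_hilbert_space set. orthonormal_basis B"
proof -
  define on where "on B \<longleftrightarrow> (\<forall>e\<in>B. \<forall>e'\<in>B. cinner e (e'::'h) = (if e = e' then 1 else 0))" for B
  have "\<exists>M\<in>Collect on. \<forall>X\<in>Collect on. M \<subseteq> X \<longrightarrow> X = M"
  proof (rule subset_Zorn')
    fix C assume C: "subset.chain (Collect on) C"
    have "cinner e e' = (if e = e' then 1 else 0)" if e: "e \<in> \<Union>C" "e' \<in> \<Union>C" for e e'
    proof -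
      obtain X Y where XY: "X \<in> C" "e \<in> X" "Y \<in> C" "e' \<in> Y" using e by blast
      then have "X \<subseteq> Y \<or> Y \<subseteq> X"
        using C by (auto simp: subset.chain_def)
      moreover have "on X" "on Y"
        using C XY by (auto simp: subset.chain_def)
      ultimately show ?thesis
        using XY unfolding on_def by blast
    qed
    then show "\<Union>C \<in> Collect on"
      by (simp add: on_def)
  qed
  then obtain M where M: "on M" and max: "\<And>X. on X \<Longrightarrow> M \<subseteq> X \<Longrightarrow> X = M"
    by auto
  have "x = 0" if x: "\<forall>e\<in>M. cinner e x = 0" for x
  proof (rule ccontr)
    assume "x \<noteq> 0"
    define e0 where "e0 = complex_of_real (1 / norm x) *\<^sub>C x"
    have "cinner e0 e0 = 1"
      using \<open>x \<noteq> 0\<close> by (simp add: cinner_self e0_def norm_scaleC norm_divide)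
    moreover have "cinner e e0 = 0" if "e \<in> M" for e
      using x that by (simp add: e0_def cinner_scaleC_right)
    moreover from this have "cinner e0 e = 0" if "e \<in> M" for e
      using that cinner_commute[of e0 e] by simp
    ultimately have "on (insert e0 M)" and "e0 \<notin> M"
      using M unfolding on_def by auto
    then show False
      using max[of "insert e0 M"] by blast
  qed
  then have "orthonormal_basis M"
    using M by (auto simp: orthonormal_basis_def on_def)
  then show ?thesis by blast
qed

text \<open>The finite partial expansions are contractions, and on a dense subspace they are
  eventually exact.\<close>

lemma orthonormal_basis_expansion:
  fixes x :: "'h::complex_hilbert_space"
  assumes B: "orthonormal_basis B"
  shows "((\<lambda>e. cinner e x *\<^sub>C e) has_sum x) B"
proof -
  define P where "P F z = (\<Sum>e\<in>F. cinner e z *\<^sub>C e)" for F and z :: 'h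
  have on: "cinner e e' = (if e = e' then 1 else 0)" if "e \<in> B" "e' \<in> B" for e e'
    using B that by (simp add: orthonormal_basis_def)
  have Padd: "P F (a + b) = P F a + P F b" for F a b
    by (simp add: P_def cinner.add_right scaleC.add_left sum.distrib)
  have Pscale: "P F (c *\<^sub>C a) = c *\<^sub>C P F a" for F a c
    by (simp add: P_def cinner_scaleC_right scaleC_scaleC scaleC.sum_right)
  have cP: "cinner e (P F z) = cinner e z" if "finite F" "F \<subseteq> B" "e \<in> F" for e F z
  proof -
    have "cinner e (P F z) = (\<Sum>e'\<in>F. if e = e' then cinner e z else 0)"
      unfolding P_def cinner.sum_right
      using that by (intro sum.cong) (auto simp: cinner_scaleC_right on subset_iff)
    then show ?thesis using that by simp
  qed
  have Pcontr: "norm (P F z) \<le> norm z" if "finite F" "F \<subseteq> B" for F z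
  proof -
    have "cinner (P F z) (P F z) = (\<Sum>e\<in>F. cnj (cinner e z) * cinner e (P F z))"
      by (subst (1) P_def) (simp add: cinner.sum_left cinner_scaleC_left)
    also have "\<dots> = (\<Sum>e\<in>F. cnj (cinner e z) * cinner e z)"
      using cP[OF that] by (intro sum.cong) auto
    also have "\<dots> = cinner (P F z) z"
      by (simp add: P_def cinner.sum_left cinner_scaleC_left)
    finally have "cinner (P F z) (P F z) = cinner (P F z) z" .
    then have "complex_of_real ((norm (P F z))\<^sup>2) = cinner (P F z) z"
      by (simp only: cinner_self)
    then have "(norm (P F z))\<^sup>2 = cmod (cinner (P F z) z)"
      by (metis norm_of_real abs_power2 real_norm_def)
    then have "norm (P F z) * norm (P F z) \<le> norm (P F z) * norm z"
      using norm_cinner_le[of "P F z" z] by (simp add: power2_eq_square)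
    then show ?thesis
      by (cases "norm (P F z) = 0") auto
  qed
  \<comment> \<open>These are the finite linear combinations of \<open>B\<close>, described without
    coefficients: every large enough partial expansion returns \<open>z\<close>.\<close>
  define D where "D = {z. \<exists>F. finite F \<and> F \<subseteq> B \<and> (\<forall>F'. finite F' \<longrightarrow> F \<subseteq> F' \<longrightarrow> F' \<subseteq> B \<longrightarrow> P F' z = z)}"
  have DI: "z \<in> D" if "finite F" "F \<subseteq> B"
      "\<And>F'. finite F' \<Longrightarrow> F \<subseteq> F' \<Longrightarrow> F' \<subseteq> B \<Longrightarrow> P F' z = z" for z F
    unfolding D_def mem_Collect_eq by (rule exI[of _ F]) (simp add: that)
  have DE: "\<exists>F. finite F \<and> F \<subseteq> B \<and> (\<forall>F'. finite F' \<longrightarrow> F \<subseteq> F' \<longrightarrow> F' \<subseteq> B \<longrightarrow> P F' z = z)"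
    if "z \<in> D" for z
    using that unfolding D_def mem_Collect_eq .
  have "csubspace D"
    unfolding csubspace_def
  proof (intro conjI ballI allI)
    show "0 \<in> D"
      by (rule DI[of "{}"]) (simp_all add: P_def cinner.zero_right scaleC.zero_left)
    fix a assume "a \<in> D"
    then obtain F1 where F1: "finite F1" "F1 \<subseteq> B"
      "\<And>F'. finite F' \<Longrightarrow> F1 \<subseteq> F' \<Longrightarrow> F' \<subseteq> B \<Longrightarrow> P F' a = a"
      using DE by metis
    show "c *\<^sub>C a \<in> D" for c
      by (rule DI[OF F1(1,2)]) (simp add: Pscale F1(3))
    fix b assume "b \<in> D"
    then obtain F2 where F2: "finite F2" "F2 \<subseteq> B"
      "\<And>F'. finite F' \<Longrightarrow> F2 \<subseteq> F' \<Longrightarrow> F' \<subseteq> B \<Longrightarrow> P F' b = b"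
      using DE by metis
    show "a + b \<in> D"
      by (rule DI[of "F1 \<union> F2"]) (simp_all add: Padd F1 F2)
  qed
  moreover have "ortho D \<subseteq> {0}"
  proof -
    have "B \<subseteq> D"
    proof
      fix e assume e: "e \<in> B"
      have "P F' e = e" if "finite F'" "{e} \<subseteq> F'" "F' \<subseteq> B" for F'
      proof -
        have "P F' e = (\<Sum>e'\<in>F'. if e' = e then e else 0)"
          unfolding P_def using that e by (intro sum.cong) (auto simp: on subset_iff)
        then show ?thesis using that by simp
      qed
      with e show "e \<in> D"
        by (intro DI[of "{e}"]) simp_all
    qed
    moreover have "\<And>x. (\<forall>e\<in>B. cinner e x = 0) \<Longrightarrow> x = 0"
      using B unfolding orthonormal_basis_def by blast
    ultimately show ?thesis
      unfolding ortho_def by blast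
  qed
  ultimately have dense: "closure D = UNIV"
    by (rule closure_UNIV_if_ortho_trivial)
  have "((\<lambda>F. P F x) \<longlongrightarrow> x) (finite_subsets_at_top B)"
    unfolding tendsto_iff eventually_finite_subsets_at_top
  proof (intro allI impI)
    fix \<epsilon> :: real assume \<epsilon>: "\<epsilon> > 0"
    have "x \<in> closure D" using dense by simp
    then obtain z where z: "z \<in> D" "dist z x < \<epsilon> / 2"
      using closure_approachable[of x D] \<epsilon> by (meson half_gt_zero)
    then obtain F where F: "finite F" "F \<subseteq> B"
      and PF: "\<And>F'. finite F' \<Longrightarrow> F \<subseteq> F' \<Longrightarrow> F' \<subseteq> B \<Longrightarrow> P F' z = z"
      using DE by metis
    have "dist (P F' x) x < \<epsilon>" if "finite F'" "F \<subseteq> F'" "F' \<subseteq> B" for F'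
    proof -
      have "P F' x - x = P F' (x - z) + (z - x)"
        using Padd[of F' "x - z" z] PF[OF that] by simp
      then have "dist (P F' x) x \<le> norm (P F' (x - z)) + norm (z - x)"
        using norm_triangle_ineq[of "P F' (x - z)" "z - x"] by (simp add: dist_norm add_diff_eq)
      also have "\<dots> \<le> norm (x - z) + norm (z - x)"
        using Pcontr that by simp
      also have "\<dots> < \<epsilon>"
        using z by (simp add: dist_norm norm_minus_commute)
      finally show ?thesis .
    qed
    then show "\<exists>X. finite X \<and> X \<subseteq> B \<and> (\<forall>Y. finite Y \<and> X \<subseteq> Y \<and> Y \<subseteq> B \<longrightarrow> dist (P Y x) x < \<epsilon>)"
      using F by blast
  qed
  then show ?thesis
    unfolding has_sum_def P_def .
qed

lemma parseval:
  assumes "orthonormal_basis B"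
  shows "((\<lambda>e. cinner e x * cinner y e) has_sum cinner y x) B"
  using has_sum_bounded_linear[OF cinner.bounded_linear_right orthonormal_basis_expansion[OF assms], of y x]
  by (simp add: cinner_scaleC_right)

lemma parseval_norm:
  assumes "orthonormal_basis B"
  shows "((\<lambda>e. (cmod (cinner e x))\<^sup>2) has_sum (norm x)\<^sup>2) B"
proof -
  have "cinner e x * cinner x e = complex_of_real ((cmod (cinner e x))\<^sup>2)" for e
    using cinner_commute[of x e] complex_norm_square[of "cinner e x"] by simp
  then show ?thesis
    using has_sum_bounded_linear[OF bounded_linear_Re parseval[OF assms, of x x]]
    by (simp add: cinner_self)
qed


subsection \<open>Double series\<close>

lemma l2_product_summable:
  fixes a b :: "'i \<Rightarrow> real"
  assumes a: "((\<lambda>i. (a i)\<^sup>2) has_sum A\<^sup>2) I" and b: "((\<lambda>i. (b i)\<^sup>2) has_sum B\<^sup>2) I"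
    and AB: "A \<ge> 0" "B \<ge> 0"
  shows "(\<lambda>i. \<bar>a i * b i\<bar>) summable_on I" and "(\<Sum>\<^sub>\<infinity>i\<in>I. \<bar>a i * b i\<bar>) \<le> A * B"
proof -
  have L2: "L2_set c F \<le> C" if "((\<lambda>i. (c i)\<^sup>2) has_sum C\<^sup>2) I" "C \<ge> 0" "finite F" "F \<subseteq> I" for c C F
  proof -
    have "(\<Sum>i\<in>F. (c i)\<^sup>2) \<le> C\<^sup>2"
      using that finite_sum_le_has_sum[OF that(1,3,4)] by simp
    then show ?thesis
      using that(2) by (simp add: L2_set_def real_le_lsqrt)
  qed
  have fin: "(\<Sum>i\<in>F. \<bar>a i * b i\<bar>) \<le> A * B" if F: "finite F" "F \<subseteq> I" for F
  proof -
    have "(\<Sum>i\<in>F. \<bar>a i * b i\<bar>) \<le> L2_set a F * L2_set b F"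
      unfolding abs_mult by (rule L2_set_mult_ineq)
    also have "\<dots> \<le> A * B"
      by (intro mult_mono L2[OF a] L2[OF b] AB F) simp
    finally show ?thesis .
  qed
  show *: "(\<lambda>i. \<bar>a i * b i\<bar>) summable_on I"
    by (rule nonneg_bdd_above_summable_on) (use fin in \<open>auto simp: bdd_above_def\<close>)
  show "(\<Sum>\<^sub>\<infinity>i\<in>I. \<bar>a i * b i\<bar>) \<le> A * B"
    by (rule infsum_le_finite_sums[OF *]) (use fin in auto)
qed

text \<open>The bounds \<open>a\<close> turn absolute summability of the rows into absolute
  summability over all pairs. Below, \<open>n\<close> numbers a nuclear series, and \<open>i\<close>
  runs over an orthonormal basis or over the Kraus index.\<close>

lemma fubini_has_sum:
  fixes c :: "'n \<Rightarrow> 'i \<Rightarrow> 'b::banach"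
  assumes row: "\<And>n. (\<lambda>i. norm (c n i)) summable_on I"
    and bound: "\<And>n. (\<Sum>\<^sub>\<infinity>i\<in>I. norm (c n i)) \<le> a n" and a: "a summable_on N"
    and s: "\<And>n. n \<in> N \<Longrightarrow> (c n has_sum s n) I"
    and t: "\<And>i. i \<in> I \<Longrightarrow> ((\<lambda>n. c n i) has_sum t i) N"
  shows "\<exists>S. (s has_sum S) N \<and> (t has_sum S) I \<and> ((\<lambda>(n, i). c n i) has_sum S) (N \<times> I)"
proof -
  have nn: "0 \<le> (\<Sum>\<^sub>\<infinity>i\<in>I. norm (c n i))" for n
    by (simp add: infsum_nonneg)
  have "(\<lambda>n. \<Sum>\<^sub>\<infinity>i\<in>I. norm (c n i)) summable_on N"
    by (rule summable_on_comparison_test[OF a]) (use bound nn in auto)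
  then have "(\<lambda>p. norm (case p of (n, i) \<Rightarrow> c n i)) summable_on N \<times> I"
    using row nn
      Infinite_Sum.abs_summable_on_Sigma_iff[where f = "\<lambda>(n, i). c n i" and A = N and B = "\<lambda>_. I"]
    by (simp add: abs_of_nonneg)
  then obtain S where S: "((\<lambda>(n, i). c n i) has_sum S) (N \<times> I)"
    using Infinite_Sum.abs_summable_summable summable_on_def by blast
  then have "((\<lambda>(i, n). c n i) has_sum S) (I \<times> N)"
    using has_sum_swap[where f = "\<lambda>(n, i). c n i" and S = S and A = N and B = I] by simp
  then have "(t has_sum S) I"
    by (rule has_sum_SigmaD) (use t in auto)
  moreover have "(s has_sum S) N"
    by (rule has_sum_SigmaD[OF S]) (use s in auto)
  ultimately show ?thesis using S by blast
qed


subsection \<open>Trace-class operators\<close>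

text \<open>Names the witnesses of \<open>trace_class\<close>, because traces and images under a
  channel are computed from the vectors of the series.\<close>

definition nuclear_rep ::
    "('h::complex_hilbert_space \<Rightarrow> 'h) \<Rightarrow> (nat \<Rightarrow> 'h) \<Rightarrow> (nat \<Rightarrow> 'h) \<Rightarrow> bool"
  where "nuclear_rep T x y \<longleftrightarrow> summable (\<lambda>n. norm (x n) * norm (y n)) \<and>
    (\<forall>v. (\<lambda>n. ket_bra (x n) (y n) v) sums T v)"

lemma trace_class_iff_nuclear_rep: "trace_class T \<longleftrightarrow> (\<exists>x y. nuclear_rep T x y)"
  by (simp add: trace_class_def nuclear_rep_def)

lemma nuclear_rep_has_sum:
  assumes "nuclear_rep T x y"
  shows "((\<lambda>n. cinner (y n) v *\<^sub>C x n) has_sum T v) UNIV"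
proof (rule norm_summable_imp_has_sum)
  have "summable (\<lambda>n. (norm (x n) * norm (y n)) * norm v)"
    using assms by (intro summable_mult2) (simp add: nuclear_rep_def)
  then show "summable (\<lambda>n. norm (cinner (y n) v *\<^sub>C x n))"
  proof (rule summable_comparison_test'[where N = 0])
    fix n
    have "cmod (cinner (y n) v) * norm (x n) \<le> norm (y n) * norm v * norm (x n)"
      by (intro mult_right_mono norm_cinner_le) simp
    then show "norm (norm (cinner (y n) v *\<^sub>C x n)) \<le> (norm (x n) * norm (y n)) * norm v"
      by (simp add: norm_scaleC mult_ac)
  qed
  show "(\<lambda>n. cinner (y n) v *\<^sub>C x n) sums T v"
    using assms by (simp add: nuclear_rep_def ket_bra_def)
qed

lemma nuclear_rep_summable_on:
  assumes "nuclear_rep T x y"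
  shows "(\<lambda>n. norm (x n) * norm (y n)) summable_on UNIV"
  using assms by (intro summable_nonneg_imp_summable_on) (auto simp: nuclear_rep_def)

lemma nuclear_rep_ket_bra: "nuclear_rep (ket_bra a b) (\<lambda>n. if n = 0 then a else 0) (\<lambda>n. b)"
proof -
  have 1: "(\<lambda>n::nat. norm (if n = 0 then a else 0) * norm b) = (\<lambda>n. if n = 0 then norm a * norm b else 0)"
    and 2: "\<And>v. (\<lambda>n::nat. ket_bra (if n = 0 then a else 0) b v) = (\<lambda>n. if n = 0 then ket_bra a b v else 0)"
    by (auto simp: ket_bra_def scaleC.zero_right)
  show ?thesis
    unfolding nuclear_rep_def 1 2
    using sums_single[of 0 "\<lambda>_. norm a * norm b"] sums_single[of 0 "\<lambda>_. ket_bra a b v" for v]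
    by (blast intro: sums_summable)
qed

lemma trace_class_ket_bra: "trace_class (ket_bra a b)"
  using nuclear_rep_ket_bra trace_class_iff_nuclear_rep by blast

text \<open>The double series of \<open>cinner e (x n) * cinner (y n) e\<close> has, by Parseval,
  the row sums \<open>cinner (y n) (x n)\<close>, in which the basis no longer occurs; its column
  sums are the diagonal entries of \<open>T\<close>.\<close>

lemma trace_op_nuclear_rep:
  fixes T :: "'h::complex_hilbert_space \<Rightarrow> 'h"
  assumes T: "nuclear_rep T x y"
  shows "((\<lambda>n. cinner (y n) (x n)) has_sum trace_op T) UNIV"
proof -
  define S where "S = (\<Sum>\<^sub>\<infinity>n. cinner (y n) (x n))"
  have main: "((\<lambda>n. cinner (y n) (x n)) has_sum S) UNIV \<and> ((\<lambda>e. cinner e (T e)) has_sum S) B"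
    if B: "orthonormal_basis B" for B
  proof -
    have "\<exists>S'. ((\<lambda>n. cinner (y n) (x n)) has_sum S') UNIV \<and> ((\<lambda>e. cinner e (T e)) has_sum S') B
        \<and> ((\<lambda>(n, e). cinner e (x n) * cinner (y n) e) has_sum S') (UNIV \<times> B)"
    proof (rule fubini_has_sum)
      fix n
      have *: "norm (cinner e (x n) * cinner (y n) e) = \<bar>cmod (cinner e (x n)) * cmod (cinner e (y n))\<bar>" for e
        using cinner_commute[of "y n" e] by (simp add: norm_mult)
      show "(\<lambda>e. norm (cinner e (x n) * cinner (y n) e)) summable_on B"
        "(\<Sum>\<^sub>\<infinity>e\<in>B. norm (cinner e (x n) * cinner (y n) e)) \<le> norm (x n) * norm (y n)"
        unfolding * by (rule l2_product_summable[OF parseval_norm[OF B] parseval_norm[OF B]]; simp)+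
      show "((\<lambda>e. cinner e (x n) * cinner (y n) e) has_sum cinner (y n) (x n)) B"
        by (rule parseval[OF B])
    next
      fix e
      show "((\<lambda>n. cinner e (x n) * cinner (y n) e) has_sum cinner e (T e)) UNIV"
        using has_sum_bounded_linear[OF cinner.bounded_linear_right nuclear_rep_has_sum[OF T, of e], of e]
        by (simp add: cinner_scaleC_right mult.commute)
    qed (rule nuclear_rep_summable_on[OF T])
    then show ?thesis
      unfolding S_def using infsumI by blast
  qed
  obtain B0 :: "'h set" where B0: "orthonormal_basis B0"
    using ex_orthonormal_basis by blast
  have "trace_op T = S"
    unfolding trace_op_def
  proof (rule the_equality)
    fix t assume "\<forall>B. orthonormal_basis B \<longrightarrow> ((\<lambda>e. cinner e (T e)) has_sum t) B"
    then show "t = S"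
      using main[OF B0] B0 has_sum_unique by blast
  qed (use main in blast)
  then show ?thesis
    using main[OF B0] by simp
qed

lemma trace_op_ket_bra: "trace_op (ket_bra a b) = cinner b a"
proof -
  have "((\<lambda>n. cinner b (if n = 0 then a else 0)) has_sum trace_op (ket_bra a b)) (UNIV::nat set)"
    using trace_op_nuclear_rep[OF nuclear_rep_ket_bra[of a b]] .
  moreover have "((\<lambda>n. cinner b (if n = 0 then a else 0)) has_sum cinner b a) (UNIV::nat set)"
    by (rule has_sum_finite_neutralI[of "{0}"]) (auto simp: cinner.zero_right)
  ultimately show ?thesis by (rule has_sum_unique)
qed

text \<open>\<open>trace_class\<close> asks for a single sequence, while the image under a channel
  has one term for each pair of a series index and a Kraus index; \<open>prod_decode\<close>
  flattens the pairs.\<close>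

lemma nuclear_rep_prodI:
  fixes x y :: "nat \<Rightarrow> nat \<Rightarrow> 'h::complex_hilbert_space"
  assumes "(\<lambda>(n, k). norm (x n k) * norm (y n k)) summable_on UNIV"
    and "\<And>v. ((\<lambda>(n, k). cinner (y n k) v *\<^sub>C x n k) has_sum T v) UNIV"
  shows "nuclear_rep T (\<lambda>m. case prod_decode m of (n, k) \<Rightarrow> x n k) (\<lambda>m. case prod_decode m of (n, k) \<Rightarrow> y n k)"
  unfolding nuclear_rep_def
proof (intro conjI allI)
  have bij: "bij_betw prod_decode UNIV UNIV"
    by (rule bij_prod_decode)
  show "summable (\<lambda>m. norm (case prod_decode m of (n, k) \<Rightarrow> x n k) * norm (case prod_decode m of (n, k) \<Rightarrow> y n k))"
    using summable_on_imp_summable[OF summable_on_reindex_bij_betw[OF bij, THEN iffD2, OF assms(1)]]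
    by (simp add: case_prod_unfold)
  fix v
  show "(\<lambda>m. ket_bra (case prod_decode m of (n, k) \<Rightarrow> x n k) (case prod_decode m of (n, k) \<Rightarrow> y n k) v) sums T v"
    using has_sum_imp_sums[OF has_sum_reindex_bij_betw[OF bij, THEN iffD2, OF assms(2)], of v]
    by (simp add: case_prod_unfold ket_bra_def)
qed


section \<open>Channels with a countable Kraus family\<close>

lemma unitary_opD:
  assumes "unitary_op V"
  shows "clinear_op V" "norm (V x) = norm x" "bounded_linear V"
    "cinner (V x) y = cinner x (adjoint_op V y)"
proof -
  show lin: "clinear_op V"
    using assms by (simp add: unitary_op_def)
  show nrm: "norm (V x) = norm x" for x
  proof -
    have "complex_of_real ((norm (V x))\<^sup>2) = complex_of_real ((norm x)\<^sup>2)"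
      using assms unfolding cinner_self[symmetric] by (simp add: unitary_op_def)
    then show ?thesis
      unfolding of_real_eq_iff by simp
  qed
  show bd: "bounded_linear V"
    by (rule clinear_op_bounded_linear[OF lin, of 1]) (simp add: nrm)
  show "cinner (V x) y = cinner x (adjoint_op V y)"
    by (rule cinner_adjoint_op[OF bd lin])
qed

text \<open>\<open>isometric\<close> is the usual trace-preservation condition, the products of
  adjoint and operator summing to the identity, written as a quadratic form so that no operator
  topology enters.\<close>

locale kraus_family =
  fixes K :: "nat \<Rightarrow> 'h::complex_hilbert_space \<Rightarrow> 'h"
  assumes linear: "clinear_op (K k)"
    and isometric: "(\<lambda>k. (norm (K k x))\<^sup>2) sums (norm x)\<^sup>2"
begin

lemma norm_le: "norm (K k x) \<le> norm x"
proof -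
  have "(\<Sum>k\<in>{k}. (norm (K k x))\<^sup>2) \<le> (\<Sum>k. (norm (K k x))\<^sup>2)"
    using isometric by (intro sum_le_suminf sums_summable) auto
  then have "(norm (K k x))\<^sup>2 \<le> (norm x)\<^sup>2"
    using sums_unique[OF isometric[of x]] by simp
  then show ?thesis by simp
qed

lemma bounded: "bounded_linear (K k)"
  by (rule clinear_op_bounded_linear[OF linear, of _ 1]) (simp add: norm_le)

lemma cinner_adj: "cinner (K k x) y = cinner x (adjoint_op (K k) y)"
  by (rule cinner_adjoint_op[OF bounded linear])

lemma isometric_has_sum: "((\<lambda>k. (norm (K k x))\<^sup>2) has_sum (norm x)\<^sup>2) UNIV"
  by (rule sums_nonneg_imp_has_sum[OF isometric]) simp

lemma product_summable: "(\<lambda>k. norm (K k x) * norm (K k y)) summable_on UNIV"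
  and product_infsum_le: "(\<Sum>\<^sub>\<infinity>k. norm (K k x) * norm (K k y)) \<le> norm x * norm y"
  using l2_product_summable[OF isometric_has_sum isometric_has_sum, of x y] by simp_all

text \<open>Polarization: real parts come from norms, and the imaginary part of
  \<open>cinner x y\<close> is minus the real part of
  \<open>cinner x (\<i> *\<^sub>C y)\<close>.\<close>

lemma cinner_has_sum: "((\<lambda>k. cinner (K k x) (K k y)) has_sum cinner x y) UNIV"
proof -
  have R: "(\<lambda>k. Re (cinner (K k x) (K k z))) sums Re (cinner x z)" for z
  proof -
    have polar: "Re (cinner a b) = ((norm (a + b))\<^sup>2 - (norm (a - b))\<^sup>2) / 4" for a b :: 'h
      by (simp add: inner_eq_Re_cinner[symmetric] power2_norm_eq_inner inner_add inner_diff inner_commute)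
    show ?thesis
      unfolding polar clinear_opD(1,4)[OF linear, symmetric]
      by (intro sums_divide sums_diff isometric)
  qed
  have "(\<lambda>k. Im (cinner (K k x) (K k y))) sums Im (cinner x y)"
    using sums_minus[OF R[of "\<i> *\<^sub>C y"]] by (simp add: clinear_opD[OF linear] cinner_scaleC_right)
  with R have sums: "(\<lambda>k. cinner (K k x) (K k y)) sums cinner x y"
    by (simp add: sums_complex_iff)
  have "summable (\<lambda>k. norm (K k x) * norm (K k y))"
    by (rule summable_on_imp_summable[OF product_summable])
  then have "summable (\<lambda>k. norm (cinner (K k x) (K k y)))"
    by (rule summable_comparison_test'[where N = 0]) (simp add: norm_cinner_le)
  then show ?thesis
    by (rule norm_summable_imp_has_sum[OF _ sums])
qed

definition channel :: "('h \<Rightarrow> 'h) \<Rightarrow> 'h \<Rightarrow> 'h"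
  where "channel X v = (\<Sum>k. K k (X (adjoint_op (K k) v)))"

lemma norm_term_le: "norm (cinner (K k y) v *\<^sub>C K k x) \<le> norm (K k x) * norm (K k y) * norm v"
proof -
  have "cmod (cinner (K k y) v) * norm (K k x) \<le> norm (K k y) * norm v * norm (K k x)"
    by (intro mult_right_mono norm_cinner_le) simp
  then show ?thesis by (simp add: norm_scaleC mult_ac)
qed

lemma term_summable: "(\<lambda>k. norm (cinner (K k y) v *\<^sub>C K k x)) summable_on UNIV"
  and term_infsum_le: "(\<Sum>\<^sub>\<infinity>k. norm (cinner (K k y) v *\<^sub>C K k x)) \<le> norm x * norm y * norm v"
proof -
  have s: "(\<lambda>k. norm (K k x) * norm (K k y) * norm v) summable_on UNIV"
    by (intro summable_on_cmult_left product_summable)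
  show 1: "(\<lambda>k. norm (cinner (K k y) v *\<^sub>C K k x)) summable_on UNIV"
    by (rule summable_on_comparison_test[OF s]) (use norm_term_le in auto)
  have "(\<Sum>\<^sub>\<infinity>k. norm (cinner (K k y) v *\<^sub>C K k x)) \<le> (\<Sum>\<^sub>\<infinity>k. norm (K k x) * norm (K k y) * norm v)"
    by (rule infsum_mono[OF 1 s norm_term_le])
  also have "\<dots> = (\<Sum>\<^sub>\<infinity>k. norm (K k x) * norm (K k y)) * norm v"
    by (rule infsum_cmult_left) (simp add: product_summable)
  also have "\<dots> \<le> norm x * norm y * norm v"
    by (intro mult_right_mono product_infsum_le) simp
  finally show "(\<Sum>\<^sub>\<infinity>k. norm (cinner (K k y) v *\<^sub>C K k x)) \<le> norm x * norm y * norm v" .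
qed

text \<open>Cauchy-Schwarz over the Kraus index bounds the n-th row by |x n| |y n| |v|, which is
  summable in n. The second claim exhibits the vectors \<open>K k (x n)\<close> and
  \<open>K k (y n)\<close> as a nuclear series for the image.\<close>

lemma channel_double_sum:
  assumes X: "nuclear_rep X x y"
  shows "((\<lambda>k. K k (X (adjoint_op (K k) v))) has_sum channel X v) UNIV"
    and "((\<lambda>(n, k). cinner (K k (y n)) v *\<^sub>C K k (x n)) has_sum channel X v) UNIV"
proof -
  define s where "s n = (\<Sum>\<^sub>\<infinity>k. cinner (K k (y n)) v *\<^sub>C K k (x n))" for n
  have "\<exists>S. (s has_sum S) UNIV \<and> ((\<lambda>k. K k (X (adjoint_op (K k) v))) has_sum S) UNIV
      \<and> ((\<lambda>(n, k). cinner (K k (y n)) v *\<^sub>C K k (x n)) has_sum S) (UNIV \<times> UNIV)"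
  proof (rule fubini_has_sum[where a = "\<lambda>n. norm (x n) * norm (y n) * norm v"])
    show "(\<lambda>k. norm (cinner (K k (y n)) v *\<^sub>C K k (x n))) summable_on UNIV"
      "(\<Sum>\<^sub>\<infinity>k. norm (cinner (K k (y n)) v *\<^sub>C K k (x n))) \<le> norm (x n) * norm (y n) * norm v" for n
      by (rule term_summable term_infsum_le)+
    show "(\<lambda>n. norm (x n) * norm (y n) * norm v) summable_on UNIV"
      by (intro summable_on_cmult_left nuclear_rep_summable_on[OF X])
    show "((\<lambda>k. cinner (K k (y n)) v *\<^sub>C K k (x n)) has_sum s n) UNIV" for n
      unfolding s_def by (rule has_sum_infsum[OF Infinite_Sum.abs_summable_summable[OF term_summable]])
    show "((\<lambda>n. cinner (K k (y n)) v *\<^sub>C K k (x n)) has_sum K k (X (adjoint_op (K k) v))) UNIV" for k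
      using has_sum_bounded_linear[OF bounded nuclear_rep_has_sum[OF X], of k "adjoint_op (K k) v"]
      by (simp add: clinear_opD[OF linear] cinner_adj)
  qed
  then obtain S where S: "((\<lambda>k. K k (X (adjoint_op (K k) v))) has_sum S) UNIV"
     "((\<lambda>(n, k). cinner (K k (y n)) v *\<^sub>C K k (x n)) has_sum S) UNIV"
    by auto
  moreover from this have "S = channel X v"
    unfolding channel_def by (intro sums_unique has_sum_imp_sums)
  ultimately show "((\<lambda>k. K k (X (adjoint_op (K k) v))) has_sum channel X v) UNIV"
    "((\<lambda>(n, k). cinner (K k (y n)) v *\<^sub>C K k (x n)) has_sum channel X v) UNIV"
    by simp_all
qed

lemma channel_sums:
  assumes "trace_class X"
  shows "(\<lambda>k. K k (X (adjoint_op (K k) v))) sums channel X v"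
  using assms channel_double_sum(1) has_sum_imp_sums trace_class_iff_nuclear_rep by blast

lemma channel_nuclear_rep:
  assumes X: "nuclear_rep X x y"
  shows "nuclear_rep (channel X) (\<lambda>m. case prod_decode m of (n, k) \<Rightarrow> K k (x n))
    (\<lambda>m. case prod_decode m of (n, k) \<Rightarrow> K k (y n))"
proof (rule nuclear_rep_prodI[OF _ channel_double_sum(2)[OF X]])
  define s where "s n = (\<Sum>\<^sub>\<infinity>k. norm (K k (x n)) * norm (K k (y n)))" for n
  have "s summable_on UNIV"
    by (rule summable_on_comparison_test[OF nuclear_rep_summable_on[OF X]])
      (auto simp: s_def infsum_nonneg product_infsum_le)
  then show "(\<lambda>(n, k). norm (K k (x n)) * norm (K k (y n))) summable_on UNIV"
    unfolding UNIV_Times_UNIV[symmetric]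
    by (rule summable_on_SigmaI[rotated]) (auto simp: s_def intro!: has_sum_infsum product_summable)
qed

text \<open>In the trace series of the image, summing over \<open>k\<close> first returns the trace
  series of \<open>X\<close>, by \<open>cinner_has_sum\<close>.\<close>

lemma trace_op_channel:
  assumes X: "nuclear_rep X x y"
  shows "trace_op (channel X) = trace_op X"
proof -
  have "((\<lambda>m. case prod_decode m of (n, k) \<Rightarrow> cinner (K k (y n)) (K k (x n)))
      has_sum trace_op (channel X)) UNIV"
    using trace_op_nuclear_rep[OF channel_nuclear_rep[OF X]] by (simp add: case_prod_unfold)
  then have "((\<lambda>(n, k). cinner (K k (y n)) (K k (x n))) has_sum trace_op (channel X)) (UNIV \<times> UNIV)"
    using has_sum_reindex_bij_betw[OF bij_prod_decode,
        of "\<lambda>(n, k). cinner (K k (y n)) (K k (x n))" "trace_op (channel X)"] by simp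
  then have "((\<lambda>n. cinner (y n) (x n)) has_sum trace_op (channel X)) UNIV"
    by (rule has_sum_SigmaD) (simp add: cinner_has_sum)
  then show ?thesis
    using trace_op_nuclear_rep[OF X] has_sum_unique by blast
qed

lemma channel_add:
  assumes "trace_class X" "trace_class Y"
  shows "channel (\<lambda>v. X v + Y v) = (\<lambda>v. channel X v + channel Y v)"
proof
  fix v
  show "channel (\<lambda>v. X v + Y v) v = channel X v + channel Y v"
    using sums_unique[OF sums_add[OF channel_sums[OF assms(1), of v] channel_sums[OF assms(2), of v]]]
    by (simp add: channel_def[of "\<lambda>v. X v + Y v"] clinear_opD[OF linear])
qed

lemma channel_scaleC:
  assumes "trace_class X"
  shows "channel (\<lambda>v. c *\<^sub>C X v) = (\<lambda>v. c *\<^sub>C channel X v)"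
proof
  fix v
  show "channel (\<lambda>v. c *\<^sub>C X v) v = c *\<^sub>C channel X v"
    using sums_unique[OF bounded_linear.sums[OF scaleC.bounded_linear_right[of c] channel_sums[OF assms, of v]]]
    by (simp add: channel_def[of "\<lambda>v. c *\<^sub>C X v"] clinear_opD[OF linear])
qed

text \<open>The k-th Kraus term contributes the block form of \<open>X\<close> at the vectors
  \<open>adjoint_op (K k) (v i)\<close>, which is nonnegative.\<close>

lemma completely_positive_channel: "completely_positive channel"
  unfolding completely_positive_def
proof (intro allI impI)
  fix n :: nat and X :: "nat \<Rightarrow> nat \<Rightarrow> 'h \<Rightarrow> 'h"
  assume tc: "\<forall>i<n. \<forall>j<n. trace_class (X i j)" and pos: "positive_block_op n X"
  show "positive_block_op n (\<lambda>i j. channel (X i j))"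
    unfolding positive_block_op_def
  proof
    fix v :: "nat \<Rightarrow> 'h"
    define q where "q k = (\<Sum>i<n. \<Sum>j<n. cinner (adjoint_op (K k) (v i)) (X i j (adjoint_op (K k) (v j))))" for k
    have "(\<lambda>k. cinner (v i) (K k (X i j (adjoint_op (K k) (v j))))) sums cinner (v i) (channel (X i j) (v j))"
      if "i < n" "j < n" for i j
      using tc that by (intro bounded_linear.sums[OF cinner.bounded_linear_right] channel_sums) auto
    moreover have "cinner w (K k u) = cinner (adjoint_op (K k) w) u" for w u k
      using cinner_adj[of k u w] by (metis cinner_commute)
    ultimately have q: "q sums (\<Sum>i<n. \<Sum>j<n. cinner (v i) (channel (X i j) (v j)))"
      unfolding q_def by (intro sums_sum) auto
    have "0 \<le> q k" for k
      unfolding q_def by (rule pos[unfolded positive_block_op_def, rule_format])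
    then have "q sums S \<Longrightarrow> 0 \<le> S" for S
      unfolding sums_complex_iff less_eq_complex_def
      using sums_le[OF _ sums_zero, of "\<lambda>k. Re (q k)" "Re S"] sums_unique2[OF sums_zero, of "Im S"] by simp
    with q show "0 \<le> (\<Sum>i<n. \<Sum>j<n. cinner (v i) (channel (X i j) (v j)))"
      by blast
  qed
qed

lemma quantum_channel: "quantum_channel channel"
  unfolding quantum_channel_def
proof (intro conjI allI impI completely_positive_channel)
  fix X Y :: "'h \<Rightarrow> 'h" and c assume X: "trace_class X"
  then obtain x y where xy: "nuclear_rep X x y"
    using trace_class_iff_nuclear_rep by blast
  show "trace_class (channel X)"
    using channel_nuclear_rep[OF xy] trace_class_iff_nuclear_rep by blast
  show "trace_op (channel X) = trace_op X"
    by (rule trace_op_channel[OF xy])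
  show "channel (\<lambda>v. c *\<^sub>C X v) = (\<lambda>v. c *\<^sub>C channel X v)"
    by (rule channel_scaleC[OF X])
  show "channel (\<lambda>v. X v + Y v) = (\<lambda>v. channel X v + channel Y v)" if "trace_class Y"
    by (rule channel_add[OF X that])
qed

section \<open>Rank-one operators, and covariance tested on a total set\<close>

lemma channel_ket_bra_has_sum:
  "((\<lambda>k. cinner (K k y) v *\<^sub>C K k x) has_sum channel (ket_bra x y) v) UNIV"
  using channel_double_sum(1)[OF nuclear_rep_ket_bra, of x y v]
  by (simp add: ket_bra_def clinear_opD[OF linear] cinner_adj)

lemma channel_ket_bra_add:
  "channel (ket_bra (x + x') y) v = channel (ket_bra x y) v + channel (ket_bra x' y) v"
  using has_sum_add[OF channel_ket_bra_has_sum[of y v x] channel_ket_bra_has_sum[of y v x']]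
    channel_ket_bra_has_sum[of y v "x + x'"]
  by (auto simp: clinear_opD[OF linear] scaleC.add_right intro: has_sum_unique)

lemma channel_ket_bra_scaleC:
  "channel (ket_bra (c *\<^sub>C x) y) v = c *\<^sub>C channel (ket_bra x y) v"
  using has_sum_bounded_linear[OF scaleC.bounded_linear_right[of c] channel_ket_bra_has_sum[of y v x]]
    channel_ket_bra_has_sum[of y v "c *\<^sub>C x"]
  by (auto simp: clinear_opD[OF linear] scaleC_scaleC mult.commute intro: has_sum_unique)

lemma norm_channel_ket_bra_le: "norm (channel (ket_bra x y) v) \<le> norm x * norm y * norm v"
  using norm_infsum_bound[OF term_summable[of y v x]] term_infsum_le[of y v x]
    infsumI[OF channel_ket_bra_has_sum[of y v x]] by simp

text \<open>The channel respects adjoints. This turns statements about the conjugate-linear slot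
  \<open>y\<close> into statements about the linear slot \<open>x\<close>.\<close>

lemma cinner_channel_ket_bra_commute:
  "cinner w (channel (ket_bra x y) v) = cnj (cinner v (channel (ket_bra y x) w))"
proof -
  have c: "((\<lambda>k. cinner (K k y) v * cinner w (K k x)) has_sum cinner w (channel (ket_bra x y) v)) UNIV"
    for x y v w
    using has_sum_bounded_linear[OF cinner.bounded_linear_right[of w] channel_ket_bra_has_sum[of y v x]]
    by (simp add: cinner_scaleC_right)
  have "cnj (cinner (K k x) w * cinner v (K k y)) = cinner (K k y) v * cinner w (K k x)" for k
    using cinner_commute[of "K k y" v] cinner_commute[of w "K k x"] by simp
  then have "((\<lambda>k. cinner (K k y) v * cinner w (K k x)) has_sum cnj (cinner v (channel (ket_bra y x) w))) UNIV"
    using has_sum_bounded_linear[OF bounded_linear_cnj c[of x w v y]] by simp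
  then show ?thesis
    by (rule has_sum_unique[OF c])
qed

lemma channel_nuclear_rep_has_sum:
  assumes "nuclear_rep X x y"
  shows "((\<lambda>n. channel (ket_bra (x n) (y n)) v) has_sum channel X v) UNIV"
proof -
  have "((\<lambda>(n, k). cinner (K k (y n)) v *\<^sub>C K k (x n)) has_sum channel X v) (UNIV \<times> UNIV)"
    using channel_double_sum(2)[OF assms] by simp
  then show ?thesis
    by (rule has_sum_SigmaD) (simp add: channel_ket_bra_has_sum)
qed

text \<open>A matrix element \<open>d\<close> of the covariance defect is a bounded linear
  functional of \<open>x\<close>, so it vanishes everywhere once it vanishes on the total set.
  Exchanging the two slots by conjugation treats \<open>y\<close> in the same way.\<close>

lemma covariant_on_ket_bra:
  assumes V: "unitary_op V" and P: "ortho P \<subseteq> {0}"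
    and gen: "\<And>p q v. p \<in> P \<Longrightarrow> q \<in> P \<Longrightarrow>
      channel (ket_bra (V p) (V q)) v = V (channel (ket_bra p q) (adjoint_op V v))"
  shows "channel (ket_bra (V x) (V y)) v = V (channel (ket_bra x y) (adjoint_op V v))"
proof -
  note lin = clinear_opD[OF unitary_opD(1)[OF V]]
  note adj = unitary_opD(4)[OF V]
  define d where "d x y v w = cinner w (channel (ket_bra (V x) (V y)) v)
    - cinner w (V (channel (ket_bra x y) (adjoint_op V v)))" for x y v w
  have ext: "d x y v w = 0" if "\<And>p. p \<in> P \<Longrightarrow> d p y v w = 0" for x y v w
  proof (rule functional_zero_if_zero_on_total[OF _ _ that P])
    show scale: "d (c *\<^sub>C x) y v w = c * d x y v w" for c x
      by (simp add: d_def lin channel_ket_bra_scaleC cinner_scaleC_right right_diff_distrib)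
    show "bounded_linear (\<lambda>x. d x y v w)"
    proof (rule bounded_linear_intro)
      show "d (a + b) y v w = d a y v w + d b y v w" for a b
        by (simp add: d_def lin channel_ket_bra_add cinner.add_right)
      show "d (r *\<^sub>R a) y v w = r *\<^sub>R d a y v w" for r a
        using scale[of "complex_of_real r" a] by (simp add: scaleC_of_real scaleR_conv_of_real)
      fix a
      have "norm (d a y v w) \<le> norm w * norm (channel (ket_bra (V a) (V y)) v)
          + norm w * norm (V (channel (ket_bra a y) (adjoint_op V v)))"
        unfolding d_def by (intro norm_triangle_le_diff add_mono norm_cinner_le)
      also have "\<dots> \<le> norm w * (norm a * norm y * norm v) + norm w * (norm a * norm y * norm (adjoint_op V v))"
        using norm_channel_ket_bra_le[of "V a" "V y" v] norm_channel_ket_bra_le[of a y "adjoint_op V v"]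
        by (intro add_mono mult_left_mono) (simp_all add: unitary_opD(2)[OF V])
      also have "\<dots> = norm a * (norm w * norm y * (norm v + norm (adjoint_op V v)))"
        by (simp add: algebra_simps)
      finally show "norm (d a y v w) \<le> norm a * (norm w * norm y * (norm v + norm (adjoint_op V v)))" .
    qed
  qed
  have comm: "d x y v w = cnj (d y x w v)" for x y v w
  proof -
    have "cinner w (V u) = cinner (adjoint_op V w) u" for u w
      using adj[of u w] cinner_commute[of w "V u"] cinner_commute[of "adjoint_op V w" u] by simp
    then show ?thesis
      using cinner_channel_ket_bra_commute[of w "V x" "V y" v]
        cinner_channel_ket_bra_commute[of "adjoint_op V w" x y "adjoint_op V v"]
      by (simp add: d_def)
  qed
  have "d p q v w = 0" if "p \<in> P" "q \<in> P" for p q v w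
    by (simp add: d_def gen[OF that])
  then have "d x q v w = 0" if "q \<in> P" for x q v w
    using ext that by blast
  then have "d q x v w = 0" if "q \<in> P" for x q v w
    using that comm[of q x v w] by simp
  then have "d x y v w = 0" for x y v w
    using ext by blast
  then show ?thesis
    by (intro eq_if_cinner_eq[of "channel (ket_bra (V x) (V y)) v"]) (simp add: d_def)
qed

text \<open>Conjugation by \<open>V\<close> applies \<open>V\<close> to both vector sequences of a
  nuclear series, so the rank-one case can be summed term by term.\<close>

lemma covariant_if_covariant_on_total:
  assumes V: "unitary_op V" and P: "ortho P \<subseteq> {0}"
    and gen: "\<And>p q v. p \<in> P \<Longrightarrow> q \<in> P \<Longrightarrow>
      channel (ket_bra (V p) (V q)) v = V (channel (ket_bra p q) (adjoint_op V v))"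
    and "trace_class X"
  shows "channel (V \<circ> X \<circ> adjoint_op V) = V \<circ> channel X \<circ> adjoint_op V"
proof
  fix v
  obtain x y where X: "nuclear_rep X x y"
    using \<open>trace_class X\<close> trace_class_iff_nuclear_rep by blast
  note lin = clinear_opD[OF unitary_opD(1)[OF V]]
  have "nuclear_rep (V \<circ> X \<circ> adjoint_op V) (\<lambda>n. V (x n)) (\<lambda>n. V (y n))"
    unfolding nuclear_rep_def
  proof (intro conjI allI)
    show "summable (\<lambda>n. norm (V (x n)) * norm (V (y n)))"
      using X by (simp add: nuclear_rep_def unitary_opD(2)[OF V])
    show "(\<lambda>n. ket_bra (V (x n)) (V (y n)) v) sums (V \<circ> X \<circ> adjoint_op V) v" for v
      using has_sum_imp_sums[OF has_sum_bounded_linear[OF unitary_opD(3)[OF V]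
          nuclear_rep_has_sum[OF X, of "adjoint_op V v"]]]
      by (simp add: ket_bra_def lin unitary_opD(4)[OF V])
  qed
  from channel_nuclear_rep_has_sum[OF this, of v]
  have 1: "((\<lambda>n. V (channel (ket_bra (x n) (y n)) (adjoint_op V v)))
      has_sum channel (V \<circ> X \<circ> adjoint_op V) v) UNIV"
    by (simp add: covariant_on_ket_bra[OF V P gen])
  have 2: "((\<lambda>n. V (channel (ket_bra (x n) (y n)) (adjoint_op V v)))
      has_sum V (channel X (adjoint_op V v))) UNIV"
    by (rule has_sum_bounded_linear[OF unitary_opD(3)[OF V] channel_nuclear_rep_has_sum[OF X]])
  show "channel (V \<circ> X \<circ> adjoint_op V) v = (V \<circ> channel X \<circ> adjoint_op V) v"
    using has_sum_unique[OF 1 2] by simp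
qed

end


text \<open>
  A family \<open>K\<close> with the defining property of a Kraus family is an isometry from \<open>\<H>\<close> into
  \<open>\<ell>\<^sup>2(\<H>)\<close>; here it is obtained by continuous extension from a densely defined one, given by its
  graph \<open>Z\<close>.
\<close>

lemma isometric_relation_extends:
  fixes Z :: "('h::complex_hilbert_space \<times> (nat \<Rightarrow> 'h)) set"
  assumes zero: "(0, \<lambda>k. 0) \<in> Z"
    and add: "\<And>z w z' w'. (z, w) \<in> Z \<Longrightarrow> (z', w') \<in> Z \<Longrightarrow> (z + z', \<lambda>k. w k + w' k) \<in> Z"
    and scale: "\<And>c z w. (z, w) \<in> Z \<Longrightarrow> (c *\<^sub>C z, \<lambda>k. c *\<^sub>C w k) \<in> Z"
    and iso: "\<And>z w. (z, w) \<in> Z \<Longrightarrow> (\<lambda>k. (norm (w k))\<^sup>2) sums (norm z)\<^sup>2"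
    and total: "ortho (fst ` Z) \<subseteq> {0}"
  shows "\<exists>K. kraus_family K \<and> (\<forall>z w. (z, w) \<in> Z \<longrightarrow> (\<forall>k. K k z = w k))"
proof -
  have csub: "csubspace (fst ` Z)"
    unfolding csubspace_def
  proof (intro conjI ballI allI)
    show "0 \<in> fst ` Z"
      by (rule image_eqI[OF _ zero]) simp
    fix a assume "a \<in> fst ` Z"
    then obtain w where a: "(a, w) \<in> Z" by auto
    show "c *\<^sub>C a \<in> fst ` Z" for c
      by (rule image_eqI[OF _ scale[OF a]]) simp
    fix b assume "b \<in> fst ` Z"
    then obtain w' where b: "(b, w') \<in> Z" by auto
    show "a + b \<in> fst ` Z"
      by (rule image_eqI[OF _ add[OF a b]]) simp
  qed
  have dense: "closure (fst ` Z) = UNIV"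
    by (rule closure_UNIV_if_ortho_trivial[OF csub total])
  have sub: "(z - z', \<lambda>k. w k - w' k) \<in> Z" if "(z, w) \<in> Z" "(z', w') \<in> Z" for z w z' w'
    using add[OF that(1) scale[OF that(2), of "-1"]] by (simp add: scaleC_minus_one)
  \<comment> \<open>The closure of \<open>Z\<close>, with images converging only coordinatewise;
    that no norm is lost in the limit is shown through \<open>q\<close>.\<close>
  define R where "R x u \<longleftrightarrow> (\<exists>z w. (\<forall>n. (z n, w n) \<in> Z) \<and> z \<longlonglongrightarrow> x \<and> (\<forall>k. (\<lambda>n. w n k) \<longlonglongrightarrow> u k))"
    for x :: 'h and u :: "nat \<Rightarrow> 'h"
  have RI: "R x u" if "\<And>n. (z n, w n) \<in> Z" "z \<longlonglongrightarrow> x" "\<And>k. (\<lambda>n. w n k) \<longlonglongrightarrow> u k" for x u z w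
    unfolding R_def using that by blast
  have RE: "\<exists>z w. (\<forall>n. (z n, w n) \<in> Z) \<and> z \<longlonglongrightarrow> x \<and> (\<forall>k. (\<lambda>n. w n k) \<longlonglongrightarrow> u k)" if "R x u" for x u
    using that unfolding R_def .
  have ZR: "R z w" if "(z, w) \<in> Z" for z w
    by (rule RI[of "\<lambda>_. z" "\<lambda>_. w"]) (simp_all add: that)
  have Radd: "R (x + x') (\<lambda>k. u k + u' k)" if R: "R x u" "R x' u'" for x x' u u'
  proof -
    obtain z w z' w' where "\<And>n. (z n, w n) \<in> Z" "z \<longlonglongrightarrow> x" "\<And>k. (\<lambda>n. w n k) \<longlonglongrightarrow> u k"
      "\<And>n. (z' n, w' n) \<in> Z" "z' \<longlonglongrightarrow> x'" "\<And>k. (\<lambda>n. w' n k) \<longlonglongrightarrow> u' k"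
      using RE[OF R(1)] RE[OF R(2)] by metis
    then show ?thesis
      by (intro RI[of "\<lambda>n. z n + z' n" "\<lambda>n k. w n k + w' n k"] add tendsto_add)
  qed
  have Rscale: "R (c *\<^sub>C x) (\<lambda>k. c *\<^sub>C u k)" if R: "R x u" for x u c
  proof -
    obtain z w where "\<And>n. (z n, w n) \<in> Z" "z \<longlonglongrightarrow> x" "\<And>k. (\<lambda>n. w n k) \<longlonglongrightarrow> u k"
      using RE[OF R] by metis
    then show ?thesis
      by (intro RI[of "\<lambda>n. c *\<^sub>C z n" "\<lambda>n k. c *\<^sub>C w n k"] scale scaleC.tendsto tendsto_const)
  qed
  have Rsub: "R (x - x') (\<lambda>k. u k - u' k)" if "R x u" "R x' u'" for x x' u u'
    using Radd[OF that(1) Rscale[OF that(2), of "-1"]] by (simp add: scaleC_minus_one)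
  \<comment> \<open>The isometry defect truncated to \<open>N\<close> coordinates. It obeys the
    parallelogram law, is nonnegative on \<open>Z\<close>, and passes to coordinatewise limits
    because the sum is finite.\<close>
  define q where "q N x u = (norm x)\<^sup>2 - (\<Sum>k<N. (norm (u k))\<^sup>2)" for N and x :: 'h and u :: "nat \<Rightarrow> 'h"
  have qZ0: "0 \<le> q N z w" if "(z, w) \<in> Z" for N z w
    using sum_le_suminf[OF sums_summable[OF iso[OF that]], of "{..<N}"] sums_unique[OF iso[OF that]]
    by (simp add: q_def)
  have q0: "0 \<le> q N x u" if R: "R x u" for N x u
  proof -
    obtain z w where zw: "\<And>n. (z n, w n) \<in> Z" "z \<longlonglongrightarrow> x" "\<And>k. (\<lambda>n. w n k) \<longlonglongrightarrow> u k"
      using RE[OF R] by metis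
    have "(\<lambda>n. q N (z n) (w n)) \<longlonglongrightarrow> q N x u"
      unfolding q_def by (intro tendsto_intros zw)
    then show ?thesis
      by (rule LIMSEQ_le_const) (use qZ0 zw in blast)
  qed
  have qpar: "q N (a + b) (\<lambda>k. u k + v k) + q N (a - b) (\<lambda>k. u k - v k) = 2 * q N a u + 2 * q N b v"
    for N a b u v
  proof -
    have "(\<Sum>k<N. (norm (u k + v k))\<^sup>2) + (\<Sum>k<N. (norm (u k - v k))\<^sup>2)
        = (\<Sum>k<N. 2 * (norm (u k))\<^sup>2 + 2 * (norm (v k))\<^sup>2)"
      by (simp add: sum.distrib[symmetric] parallelogram)
    then show ?thesis
      using parallelogram[of a b] by (simp add: q_def sum.distrib sum_distrib_left[symmetric])
  qed
  have Riso: "(\<lambda>k. (norm (u k))\<^sup>2) sums (norm x)\<^sup>2" if R: "R x u" for x u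
  proof -
    have "(\<lambda>N. q N x u) \<longlonglongrightarrow> 0"
    proof (rule LIMSEQ_I)
      fix e :: real assume e: "e > 0"
      have "x \<in> closure (fst ` Z)" using dense by simp
      moreover have "sqrt (e / 4) > 0" using e by simp
      ultimately obtain z where "z \<in> fst ` Z" and dist: "dist z x < sqrt (e / 4)"
        using closure_approachable[of x "fst ` Z"] by blast
      then obtain w where zw: "(z, w) \<in> Z" by auto
      have "(norm (x - z))\<^sup>2 < (sqrt (e / 4))\<^sup>2"
        using dist by (intro power_strict_mono) (simp_all add: dist_norm norm_minus_commute)
      then have d: "(norm (x - z))\<^sup>2 < e / 4"
        using e by simp
      have "(\<lambda>N. q N z w) \<longlonglongrightarrow> (norm z)\<^sup>2 - (norm z)\<^sup>2"
        unfolding q_def using iso[OF zw] by (intro tendsto_diff tendsto_const) (simp add: sums_def)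
      then obtain M where M: "\<And>N. N \<ge> M \<Longrightarrow> norm (q N z w) < e / 4"
        using LIMSEQ_D[of "\<lambda>N. q N z w" 0 "e / 4"] e by auto
      have "norm (q N x u - 0) < e" if "N \<ge> M" for N
      proof -
        have R1: "R (x - z) (\<lambda>k. u k - w k)"
          by (rule Rsub[OF R ZR[OF zw]])
        \<comment> \<open>The parallelogram law for \<open>z\<close> and \<open>x - z\<close>, with
          the nonnegative defect of their difference dropped, bounds the defect of \<open>x\<close>.
          The defect of \<open>z\<close> tends to 0 and that of \<open>x - z\<close> is at most its
          squared norm; each is below e / 4 and enters twice.\<close>
        have "0 \<le> q N (z - (x - z)) (\<lambda>k. w k - (u k - w k))"
          by (rule q0[OF Rsub[OF ZR[OF zw] R1]])
        then have "q N x u \<le> 2 * q N z w + 2 * q N (x - z) (\<lambda>k. u k - w k)"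
          using qpar[of N z "x - z" w "\<lambda>k. u k - w k"] by simp
        also have "q N (x - z) (\<lambda>k. u k - w k) \<le> (norm (x - z))\<^sup>2"
          by (simp add: q_def sum_nonneg)
        finally show ?thesis
          using q0[OF R, of N] M[OF that] d by simp
      qed
      then show "\<exists>no. \<forall>n\<ge>no. norm (q n x u - 0) < e" by blast
    qed
    from tendsto_diff[OF tendsto_const this, of "(norm x)\<^sup>2"]
    show ?thesis by (simp add: q_def sums_def)
  qed
  have Rtotal: "\<exists>u. R x u" for x
  proof -
    have "x \<in> closure (fst ` Z)" using dense by simp
    then obtain z where z: "\<And>n. z n \<in> fst ` Z" "z \<longlonglongrightarrow> x"
      unfolding closure_sequential by blast
    have "\<exists>w. (z n, w) \<in> Z" for n using z(1)[of n] by auto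
    then have "\<exists>w. \<forall>n. (z n, w n) \<in> Z" by (intro choice) blast
    then obtain w where zw: "\<And>n. (z n, w n) \<in> Z" by blast
    have "Cauchy z" using z(2) LIMSEQ_imp_Cauchy by blast
    \<comment> \<open>A single coordinate is dominated by the whole square sum, so the coordinates
      of the images inherit the Cauchy property from \<open>z\<close>.\<close>
    have le: "dist (w m k) (w n k) \<le> dist (z m) (z n)" for m n k
    proof -
      have "(\<Sum>i\<in>{k}. (norm (w m i - w n i))\<^sup>2) \<le> (norm (z m - z n))\<^sup>2"
        using sum_le_suminf[OF sums_summable[OF iso[OF sub[OF zw[of m] zw[of n]]]], of "{k}"]
          sums_unique[OF iso[OF sub[OF zw[of m] zw[of n]]]] by simp
      then show ?thesis by (simp add: dist_norm)
    qed
    have "convergent (\<lambda>n. w n k)" for k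
    proof -
      have "Cauchy (\<lambda>n. w n k)"
        using \<open>Cauchy z\<close> le[of _ k] unfolding Cauchy_def by (meson le_less_trans)
      then show ?thesis by (simp add: Cauchy_convergent_iff)
    qed
    then show ?thesis
      using RI[OF zw z(2), of "\<lambda>k. lim (\<lambda>n. w n k)"] by (auto simp: convergent_LIMSEQ_iff)
  qed
  \<comment> \<open>The difference of two images of \<open>x\<close> is an image of 0, hence has
    norm 0 in every coordinate.\<close>
  have Runique: "u = u'" if "R x u" "R x u'" for x u u'
  proof
    fix k
    have "(\<Sum>i\<in>{k}. (norm (u i - u' i))\<^sup>2) \<le> (norm (x - x))\<^sup>2"
      using sum_le_suminf[OF sums_summable[OF Riso[OF Rsub[OF that]]], of "{k}"]
        sums_unique[OF Riso[OF Rsub[OF that]]] by simp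
    then show "u k = u' k" by simp
  qed
  define T where "T x = (SOME u. R x u)" for x
  have T: "R x (T x)" for x
    unfolding T_def by (rule someI_ex[OF Rtotal])
  have "kraus_family (\<lambda>k x. T x k)"
  proof
    show "clinear_op (\<lambda>x. T x k)" for k
      unfolding clinear_op_def
      using Runique[OF T Radd[OF T T]] Runique[OF T Rscale[OF T]] by simp
    show "(\<lambda>k. (norm (T x k))\<^sup>2) sums (norm x)\<^sup>2" for x
      by (rule Riso[OF T])
  qed
  moreover have "T z k = w k" if "(z, w) \<in> Z" for z w k
    using Runique[OF T ZR[OF that]] by simp
  ultimately show ?thesis by blast
qed


section \<open>Positive semidefinite kernels\<close>

text \<open>The index set is arbitrary because two kinds of points occur: group elements, where
  unfolding \<open>positive_definite\<close> gives exactly this property, and pairs of a group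
  element and a vector.\<close>

definition psd_on :: "'a set \<Rightarrow> ('a \<Rightarrow> 'a \<Rightarrow> complex) \<Rightarrow> bool"
  where "psd_on I F \<longleftrightarrow> (\<forall>n. \<forall>x :: nat \<Rightarrow> 'a. \<forall>\<alpha> :: nat \<Rightarrow> complex. (\<forall>i<n. x i \<in> I) \<longrightarrow>
    0 \<le> (\<Sum>i<n. \<Sum>j<n. cnj (\<alpha> i) * \<alpha> j * F (x i) (x j)))"

lemma psd_onD:
  fixes x :: "nat \<Rightarrow> 'a"
  assumes "psd_on I F" "\<And>i. i < n \<Longrightarrow> x i \<in> I"
  shows "0 \<le> (\<Sum>i<n. \<Sum>j<n. cnj (\<alpha> i) * \<alpha> j * F (x i) (x j))"
  using assms unfolding psd_on_def by simp

lemma psd_on_pair: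
  assumes "psd_on I F" "x \<in> I" "y \<in> I"
  shows "0 \<le> cnj a * a * F x x + cnj a * b * F x y + cnj b * a * F y x + cnj b * b * F y y"
  using psd_onD[OF assms(1), of 2 "\<lambda>i. if i = 0 then x else y" "\<lambda>i. if i = 0 then a else b"] assms(2,3)
  by (simp add: numeral_2_eq_2 algebra_simps)

lemma psd_on_diag:
  assumes "psd_on I F" "x \<in> I"
  shows "0 \<le> Re (F x x)" "F x x = complex_of_real (Re (F x x))"
  using psd_on_pair[OF assms assms(2), of 1 0] by (auto simp: less_eq_complex_def complex_eq_iff)

text \<open>Reality of the form at the coefficients (1, 1) compares imaginary parts, and at (1,
  \<i>) real parts.\<close>

lemma psd_on_hermitian:
  assumes "psd_on I F" "x \<in> I" "y \<in> I"
  shows "F y x = cnj (F x y)"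
  using psd_on_pair[OF assms, of 1 1] psd_on_pair[OF assms, of 1 \<i>]
    psd_on_diag(2)[OF assms(1,2)] psd_on_diag(2)[OF assms(1,3)]
  by (auto simp: less_eq_complex_def complex_eq_iff)

lemma psd_on_zero_row:
  assumes F: "psd_on I F" and xy: "x \<in> I" "y \<in> I" and "F x x = 0"
  shows "F x y = 0"
proof (rule ccontr)
  assume nz: "F x y \<noteq> 0"
  define r where "r = Re (F y y)"
  define m where "m = (cmod (F x y))\<^sup>2"
  \<comment> \<open>Chosen so that the form at the coefficients -t F(x, y) and 1, which equals r - 2
    t m, takes the value -1.\<close>
  define t where "t = (r + 1) / (2 * m)"
  have m: "m > 0" using nz by (simp add: m_def)
  have "F x y * cnj (F x y) = complex_of_real m"
    using complex_norm_square[of "F x y"] by (simp add: m_def)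
  then have "0 \<le> complex_of_real (r - 2 * (t * m))"
    using psd_on_pair[OF F xy, of "- complex_of_real t * F x y" 1] \<open>F x x = 0\<close>
      psd_on_hermitian[OF F xy] psd_on_diag(2)[OF F xy(2)]
    by (simp add: r_def mult_ac)
  moreover have "t * m = (r + 1) / 2"
    using m by (simp add: t_def)
  ultimately show False
    by (simp add: less_eq_complex_def)
qed

text \<open>One step of the Cholesky decomposition; for a vanishing pivot \<open>F p p\<close> the division by zero
  leaves \<open>F\<close> unchanged, and then the row of \<open>p\<close> vanishes already.\<close>

definition schur_complement :: "'a \<Rightarrow> ('a \<Rightarrow> 'a \<Rightarrow> complex) \<Rightarrow> 'a \<Rightarrow> 'a \<Rightarrow> complex"
  where "schur_complement p F x y = F x y - F x p * F p y / F p p"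

lemma psd_on_schur_complement:
  assumes F: "psd_on I F" and p: "p \<in> I"
  shows "psd_on I (schur_complement p F)"
proof (cases "F p p = 0")
  case True
  then have "schur_complement p F = F"
    by (simp add: schur_complement_def fun_eq_iff)
  then show ?thesis using F by simp
next
  case False
  define \<kappa> where "\<kappa> = F p p"
  have \<kappa>: "\<kappa> \<noteq> 0" "cnj \<kappa> = \<kappa>"
    using False psd_on_diag(2)[OF F p] unfolding \<kappa>_def by (simp, metis complex_cnj_complex_of_real)
  show ?thesis
    unfolding psd_on_def
  proof (intro allI impI)
    fix n and x :: "nat \<Rightarrow> 'a" and \<alpha> :: "nat \<Rightarrow> complex"
    assume x: "\<forall>i<n. x i \<in> I"
    define s where "s = (\<Sum>j<n. \<alpha> j * F p (x j))"
    define Q where "Q = (\<Sum>i<n. \<Sum>j<n. cnj (\<alpha> i) * \<alpha> j * F (x i) (x j))"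
    \<comment> \<open>The coefficient that minimizes the form when \<open>p\<close> is added as a
      further point; the minimum \<open>Q\<close> - |s|^2 / \<kappa> is the form of the Schur
      complement.\<close>
    define \<beta> where "\<beta> = - s / \<kappa>"
    have cs: "cnj s = (\<Sum>i<n. cnj (\<alpha> i) * F (x i) p)"
      unfolding s_def cnj_sum using x psd_on_hermitian[OF F p] by (intro sum.cong) auto
    have "0 \<le> (\<Sum>i<Suc n. \<Sum>j<Suc n. cnj ((\<alpha>(n := \<beta>)) i) * (\<alpha>(n := \<beta>)) j * F ((x(n := p)) i) ((x(n := p)) j))"
      by (rule psd_onD[OF F]) (use x p in auto)
    also have "\<dots> = Q + (\<Sum>i<n. cnj (\<alpha> i) * \<beta> * F (x i) p) + ((\<Sum>j<n. cnj \<beta> * \<alpha> j * F p (x j)) + cnj \<beta> * \<beta> * \<kappa>)"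
      by (simp add: sum.distrib Q_def \<kappa>_def)
    also have "(\<Sum>i<n. cnj (\<alpha> i) * \<beta> * F (x i) p) = cnj s * \<beta>"
      by (simp add: cs sum_distrib_left sum_distrib_right mult_ac)
    also have "(\<Sum>j<n. cnj \<beta> * \<alpha> j * F p (x j)) = cnj \<beta> * s"
      by (simp add: s_def sum_distrib_left mult_ac)
    also have "Q + cnj s * \<beta> + (cnj \<beta> * s + cnj \<beta> * \<beta> * \<kappa>) = Q - cnj s * s / \<kappa>"
      using \<kappa> by (simp add: \<beta>_def field_simps)
    also have "cnj s * s / \<kappa> = (\<Sum>i<n. \<Sum>j<n. cnj (\<alpha> i) * \<alpha> j * (F (x i) p * F p (x j) / \<kappa>))"
      unfolding cs unfolding s_def sum_product sum_divide_distrib by (simp add: mult_ac)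
    also have "Q - \<dots> = (\<Sum>i<n. \<Sum>j<n. cnj (\<alpha> i) * \<alpha> j * schur_complement p F (x i) (x j))"
      by (simp add: Q_def schur_complement_def \<kappa>_def sum_subtractf[symmetric] right_diff_distrib)
    finally show "0 \<le> (\<Sum>i<n. \<Sum>j<n. cnj (\<alpha> i) * \<alpha> j * schur_complement p F (x i) (x j))" .
  qed
qed

text \<open>For a nonzero pivot \<open>F x x\<close> this is nonnegativity of the Schur complement's
  diagonal entry at \<open>y\<close>.\<close>

lemma psd_on_cauchy_schwarz:
  assumes F: "psd_on I F" and xy: "x \<in> I" "y \<in> I"
  shows "(cmod (F x y))\<^sup>2 \<le> Re (F x x) * Re (F y y)"
proof (cases "F x x = 0")
  case True
  then show ?thesis using psd_on_zero_row[OF F xy] by simp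
next
  case False
  define r where "r = Re (F x x)"
  have r: "F x x = complex_of_real r" "r > 0"
    using psd_on_diag[OF F xy(1)] False unfolding r_def by (auto simp: less_le)
  have "0 \<le> Re (F y y - F y x * F x y / F x x)"
    using psd_on_diag(1)[OF psd_on_schur_complement[OF F xy(1)] xy(2)]
    by (simp add: schur_complement_def)
  also have "F y x * F x y = complex_of_real ((cmod (F x y))\<^sup>2)"
    using psd_on_hermitian[OF F xy] complex_norm_square[of "F x y"] by (simp add: mult.commute)
  finally show ?thesis
    using r by (simp add: r(1) field_simps flip: of_real_power)
qed

section \<open>Cholesky decomposition along a sequence of pivots\<close>

primrec cholesky_rest :: "(nat \<Rightarrow> 'a) \<Rightarrow> ('a \<Rightarrow> 'a \<Rightarrow> complex) \<Rightarrow> nat \<Rightarrow> 'a \<Rightarrow> 'a \<Rightarrow> complex"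
  where
    "cholesky_rest p F 0 = F"
  | "cholesky_rest p F (Suc n) = schur_complement (p n) (cholesky_rest p F n)"

text \<open>The expression in \<open>dense\<close> is the squared distance of \<open>x\<close> and
  \<open>p i\<close> when \<open>F\<close> is read as a kernel of inner products. Elimination never
  increases this distance and annihilates the rows of past pivots, so the remaining diagonal entry
  at \<open>x\<close> is at most the original squared distance from \<open>x\<close> to any past
  pivot. Off the diagonal, Cauchy-Schwarz applies.\<close>

lemma psd_on_decomposition:
  fixes F :: "'a \<Rightarrow> 'a \<Rightarrow> complex" and p :: "nat \<Rightarrow> 'a"
  assumes F: "psd_on I F" and p: "\<And>n. p n \<in> I"
    and dense: "\<And>x \<epsilon>. x \<in> I \<Longrightarrow> \<epsilon> > 0 \<Longrightarrow> \<exists>i. Re (F x x) + Re (F (p i) (p i)) - 2 * Re (F x (p i)) < \<epsilon>"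
  shows "\<exists>c. \<forall>x\<in>I. \<forall>y\<in>I. (\<lambda>k. cnj (c k x) * c k y) sums F x y"
proof -
  define S where "S = cholesky_rest p F"
  have S0: "S 0 = F" and SSuc: "S (Suc n) x y = S n x y - S n x (p n) * S n (p n) y / S n (p n) (p n)" for n x y
    by (simp_all add: S_def schur_complement_def)
  have psd: "psd_on I (S n)" for n
    by (induction n) (simp_all add: S_def F psd_on_schur_complement p)
  \<comment> \<open>At a vanishing pivot the division by zero yields 0, in agreement with a Schur
    complement that leaves the kernel unchanged.\<close>
  define c where "c k x = S k (p k) x / complex_of_real (sqrt (Re (S k (p k) (p k))))" for k x
  have step: "S k x y = cnj (c k x) * c k y + S (Suc k) x y" if "x \<in> I" "y \<in> I" for k x y
  proof -
    have "cnj (S k (p k) x) = S k x (p k)"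
      using psd_on_hermitian[OF psd p \<open>x \<in> I\<close>, of k k] by simp
    then have "cnj (c k x) * c k y = S k x (p k) * S k (p k) y
        / (complex_of_real (sqrt (Re (S k (p k) (p k)))) * complex_of_real (sqrt (Re (S k (p k) (p k)))))"
      by (simp add: c_def)
    also have "complex_of_real (sqrt (Re (S k (p k) (p k)))) * complex_of_real (sqrt (Re (S k (p k) (p k))))
        = S k (p k) (p k)"
      using psd_on_diag[OF psd p, of k k] by (simp flip: of_real_mult)
    finally show ?thesis by (simp add: SSuc)
  qed
  have partial: "F x y = (\<Sum>k<n. cnj (c k x) * c k y) + S n x y" if "x \<in> I" "y \<in> I" for n x y
    by (induction n) (simp_all add: S0 step[OF that, symmetric] add.assoc)
  have row: "S n (p i) y = 0" if "i < n" "y \<in> I" for n i y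
    using that
  proof (induction n arbitrary: y)
    case (Suc n)
    then consider "i < n" | "i = n" by linarith
    then show ?case
    proof cases
      case 1
      have "S n (p i) (p n) = 0 \<and> S n (p i) y = 0"
        using Suc.IH[OF 1] Suc.prems(2) p by simp
      then show ?thesis by (simp add: SSuc)
    next
      case 2
      then show ?thesis
        using psd_on_zero_row[OF psd p Suc.prems(2), of n n] by (cases "S n (p n) (p n) = 0") (simp_all add: SSuc)
    qed
  qed simp
  define d where "d n x z = Re (S n x x) + Re (S n z z) - 2 * Re (S n x z)" for n x z
  \<comment> \<open>The subtracted rank-one kernel accounts for exactly |c n x - c n z|^2 of the
    squared distance.\<close>
  have d_step: "d (Suc n) x z \<le> d n x z" if "x \<in> I" "z \<in> I" for n x z
  proof -
    have "d n x z - d (Suc n) x z = (cmod (c n x - c n z))\<^sup>2"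
      unfolding d_def step[OF that(1,1), of n] step[OF that(2,2), of n] step[OF that, of n]
      by (simp add: cmod_power2) (simp add: power2_eq_square algebra_simps)
    then show ?thesis using zero_le_power2[of "cmod (c n x - c n z)"] by linarith
  qed
  have d_le: "d n x z \<le> d 0 x z" if "x \<in> I" "z \<in> I" for n x z
    by (induction n) (use d_step[OF that] order_trans in auto)
  have diag_lim: "(\<lambda>n. Re (S n x x)) \<longlonglongrightarrow> 0" if x: "x \<in> I" for x
  proof (rule LIMSEQ_I)
    fix e :: real assume "e > 0"
    then obtain i where i: "d 0 x (p i) < e"
      using dense[OF x] unfolding d_def S0 by blast
    have "norm (Re (S n x x) - 0) < e" if "n \<ge> Suc i" for n
    proof -
      have "S n x (p i) = 0" "S n (p i) (p i) = 0"
        using row[of i n x] row[of i n "p i"] that x p psd_on_hermitian[OF psd p x, of n i] by auto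
      then have "Re (S n x x) = d n x (p i)"
        by (simp add: d_def)
      then show ?thesis
        using d_le[OF x p, of n i] i psd_on_diag(1)[OF psd x, of n] by simp
    qed
    then show "\<exists>no. \<forall>n\<ge>no. norm (Re (S n x x) - 0) < e" by blast
  qed
  have "(\<lambda>k. cnj (c k x) * c k y) sums F x y" if xy: "x \<in> I" "y \<in> I" for x y
  proof -
    have "(\<lambda>n. (cmod (S n x y))\<^sup>2) \<longlonglongrightarrow> 0"
    proof (rule tendsto_sandwich[OF _ _ tendsto_const])
      show "(\<lambda>n. Re (S n x x) * Re (S n y y)) \<longlonglongrightarrow> 0"
        using tendsto_mult[OF diag_lim[OF xy(1)] diag_lim[OF xy(2)]] by simp
    qed (simp_all add: psd_on_cauchy_schwarz[OF psd xy])
    then have "(\<lambda>n. S n x y) \<longlonglongrightarrow> 0"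
      using tendsto_real_sqrt[of "\<lambda>n. (cmod (S n x y))\<^sup>2" 0] tendsto_norm_zero_iff by fastforce
    then have "(\<lambda>n. F x y - S n x y) \<longlonglongrightarrow> F x y"
      using tendsto_diff[OF tendsto_const, of "\<lambda>n. S n x y" 0 sequentially "F x y"] by simp
    moreover have "F x y - S n x y = (\<Sum>k<n. cnj (c k x) * c k y)" for n
      using partial[OF xy, of n] by simp
    ultimately show ?thesis by (simp add: sums_def)
  qed
  then show ?thesis by blast
qed


section \<open>Kraus operators with prescribed values on generators\<close>

lemma ortho_antimono: "A \<subseteq> B \<Longrightarrow> ortho B \<subseteq> ortho A"
  by (auto simp: ortho_def)

text \<open>The linear span is kept as a relation, since the generators may be linearly dependent;
  that it is single-valued comes out of isometry later.\<close>

inductive_set relation_span ::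
    "('h::complex_hilbert_space \<times> (nat \<Rightarrow> 'h)) set \<Rightarrow> ('h \<times> (nat \<Rightarrow> 'h)) set"
  for \<Gamma> where
    zero: "(0, \<lambda>k. 0) \<in> relation_span \<Gamma>"
  | gen: "p \<in> \<Gamma> \<Longrightarrow> p \<in> relation_span \<Gamma>"
  | add: "(z, w) \<in> relation_span \<Gamma> \<Longrightarrow> (z', w') \<in> relation_span \<Gamma> \<Longrightarrow>
      (z + z', \<lambda>k. w k + w' k) \<in> relation_span \<Gamma>"
  | scale: "(z, w) \<in> relation_span \<Gamma> \<Longrightarrow> (c *\<^sub>C z, \<lambda>k. c *\<^sub>C w k) \<in> relation_span \<Gamma>"

text \<open>Preservation of inner products is sesquilinear, so it spreads from generators to the
  span one argument at a time; norms alone on the generators would not suffice.\<close>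

lemma kraus_family_from_generators:
  fixes \<Gamma> :: "('h::complex_hilbert_space \<times> (nat \<Rightarrow> 'h)) set"
  assumes iso: "\<And>p q. p \<in> \<Gamma> \<Longrightarrow> q \<in> \<Gamma> \<Longrightarrow>
      (\<lambda>k. cinner (snd p k) (snd q k)) sums cinner (fst p) (fst q)"
    and total: "ortho (fst ` \<Gamma>) \<subseteq> {0}"
  shows "\<exists>K. kraus_family K \<and> (\<forall>p\<in>\<Gamma>. \<forall>k. K k (fst p) = snd p k)"
proof -
  let ?Z = "relation_span \<Gamma>"
  have 1: "(\<lambda>k. cinner (snd p k) (snd q k)) sums cinner (fst p) (fst q)" if "p \<in> ?Z" "q \<in> \<Gamma>" for p q
    using that(1)
  proof (induction rule: relation_span.induct)
    case zero
    then show ?case by (simp add: cinner.zero_left)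
  next
    case (gen p)
    then show ?case using iso that by blast
  next
    case (add z w z' w')
    then show ?case by (simp add: cinner.add_left sums_add)
  next
    case (scale z w c)
    then show ?case by (simp add: cinner_scaleC_left sums_mult)
  qed
  have 2: "(\<lambda>k. cinner (snd p k) (snd q k)) sums cinner (fst p) (fst q)" if "p \<in> ?Z" "q \<in> ?Z" for p q
    using that(2)
  proof (induction rule: relation_span.induct)
    case zero
    then show ?case by (simp add: cinner.zero_right)
  next
    case (gen q)
    then show ?case using 1 that by blast
  next
    case (add z w z' w')
    then show ?case by (simp add: cinner.add_right sums_add)
  next
    case (scale z w c)
    then show ?case by (simp add: cinner_scaleC_right sums_mult)
  qed
  have "\<exists>K. kraus_family K \<and> (\<forall>z w. (z, w) \<in> ?Z \<longrightarrow> (\<forall>k. K k z = w k))"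
  proof (rule isometric_relation_extends[OF relation_span.zero relation_span.add relation_span.scale])
    show "(\<lambda>k. (norm (w k))\<^sup>2) sums (norm z)\<^sup>2" if "(z, w) \<in> ?Z" for z w
      using bounded_linear.sums[OF bounded_linear_Re 2[OF that that]] by (simp add: cinner_self)
    have "fst ` \<Gamma> \<subseteq> fst ` ?Z"
      using relation_span.gen by blast
    then show "ortho (fst ` ?Z) \<subseteq> {0}"
      by (rule order_trans[OF ortho_antimono total])
  qed
  then obtain K where K: "kraus_family K" "\<And>z w k. (z, w) \<in> ?Z \<Longrightarrow> K k z = w k"
    by blast
  have "K k (fst p) = snd p k" if "p \<in> \<Gamma>" for p k
    using K(2)[of "fst p" "snd p" k] relation_span.gen[OF that] by simp
  then show ?thesis
    by (intro exI[of _ K] conjI K(1) ballI allI)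
qed


section \<open>Covariant conversion of pure states\<close>

lemma unitary_conj_ket_bra:
  assumes "unitary_op V"
  shows "V \<circ> ket_bra x y \<circ> adjoint_op V = ket_bra (V x) (V y)"
  by (simp add: fun_eq_iff ket_bra_def clinear_opD[OF unitary_opD(1)[OF assms]] unitary_opD(4)[OF assms])

lemma trace_class_clinear:
  assumes "trace_class T"
  shows "clinear_op T"
proof -
  obtain x y where T: "\<And>v. (\<lambda>n. cinner (y n) v *\<^sub>C x n) sums T v"
    using assms by (auto simp: trace_class_def ket_bra_def)
  show ?thesis
    unfolding clinear_op_def
  proof (intro conjI allI)
    fix u v c
    show "T (u + v) = T u + T v"
      using sums_unique2[OF T[of "u + v"]] sums_add[OF T[of u] T[of v]]
      by (simp add: cinner.add_right scaleC.add_left)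
    show "T (c *\<^sub>C v) = c *\<^sub>C T v"
      using sums_unique2[OF T[of "c *\<^sub>C v"]] bounded_linear.sums[OF scaleC.bounded_linear_right[of c] T[of v]]
      by (simp add: cinner_scaleC_right scaleC_scaleC)
  qed
qed

locale unitary_representation = group G for G :: "('g, 'm) monoid_scheme" (structure) +
  fixes U :: "'g \<Rightarrow> 'h::complex_hilbert_space \<Rightarrow> 'h"
  assumes rep: "unitary_rep G U"
begin

lemma unitary: "g \<in> carrier G \<Longrightarrow> unitary_op (U g)"
  using rep by (simp add: unitary_rep_def)

lemma U_mult: "g \<in> carrier G \<Longrightarrow> h \<in> carrier G \<Longrightarrow> U (g \<otimes> h) x = U g (U h x)"
  using rep by (simp add: unitary_rep_def)

text \<open>\<open>unitary_rep\<close> asks for multiplicativity only; \<open>U \<one>\<close> is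
  then idempotent and isometric, hence the identity.\<close>

lemma U_one: "U \<one> x = x"
proof -
  have "norm (U \<one> x - x) = norm (U \<one> (U \<one> x - x))"
    by (simp add: unitary_opD(2)[OF unitary])
  also have "U \<one> (U \<one> x - x) = 0"
    using U_mult[of \<one> \<one> x] by (simp add: clinear_opD(4)[OF unitary_opD(1)[OF unitary]])
  finally show ?thesis by simp
qed

lemma adjoint_U: "g \<in> carrier G \<Longrightarrow> adjoint_op (U g) = U (inv g)"
proof (rule adjoint_op_eqI)
  fix x y assume g: "g \<in> carrier G"
  have "cinner (U g x) y = cinner (U g x) (U g (U (inv g) y))"
    using g by (simp flip: U_mult add: U_one)
  also have "\<dots> = cinner x (U (inv g) y)"
    using unitary[OF g] by (simp add: unitary_op_def)
  finally show "cinner (U g x) y = cinner x (U (inv g) y)" .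
qed

lemma cinner_U_U:
  assumes "g \<in> carrier G" "h \<in> carrier G"
  shows "cinner (U g x) (U h y) = cinner x (U (inv g \<otimes> h) y)"
  using assms unitary_opD(4)[OF unitary, of g x "U h y"] by (simp add: adjoint_U U_mult)

subsection \<open>From a channel to a positive definite function\<close>

lemma positive_definite_from_channel:
  assumes E: "quantum_channel \<E>" and cov: "covariant G U \<E>"
    and conv: "\<E> (ket_bra \<psi> \<psi>) = ket_bra \<phi> \<phi>" and \<phi>: "norm \<phi> = 1"
  shows "\<exists>f. positive_definite G f \<and>
    (\<forall>g\<in>carrier G. characteristic_function U \<psi> g = characteristic_function U \<phi> g * f g)"
proof -
  define T where "T g h = \<E> (ket_bra (U g \<psi>) (U h \<psi>))" for g h
  have T_lin: "clinear_op (T g h)" for g h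
    using E unfolding T_def quantum_channel_def by (blast intro: trace_class_clinear trace_class_ket_bra)
  have cov_ket: "\<E> (ket_bra (U g x) (U g y)) = U g \<circ> \<E> (ket_bra x y) \<circ> U (inv g)"
    if "g \<in> carrier G" for g x y
    using cov[unfolded covariant_def, rule_format, OF that trace_class_ket_bra[of x y]]
    unfolding unitary_conj_ket_bra[OF unitary[OF that]]
    unfolding adjoint_U[OF that] .
  have T_diag: "T g g = ket_bra (U g \<phi>) (U g \<phi>)" if "g \<in> carrier G" for g
    unfolding T_def cov_ket[OF that] conv adjoint_U[OF that, symmetric]
    by (rule unitary_conj_ket_bra[OF unitary[OF that]])
  \<comment> \<open>Attaching a vector to each group element turns the operator-valued kernel into a
    scalar one, to which Cauchy-Schwarz applies with arbitrary vectors on both sides.\<close>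
  define F where "F p q = cinner (snd p) (T (fst p) (fst q) (snd q))" for p q
  have psd: "psd_on (carrier G \<times> UNIV) F"
    unfolding psd_on_def
  proof (intro allI impI)
    fix n and p :: "nat \<Rightarrow> 'g \<times> 'h" and \<alpha> :: "nat \<Rightarrow> complex"
    \<comment> \<open>The block operator with entries |x_i><x_j| is positive: its form is the
      squared modulus of a single sum \<open>s\<close>.\<close>
    let ?X = "\<lambda>i j. ket_bra (U (fst (p i)) \<psi>) (U (fst (p j)) \<psi>)"
    have "positive_block_op n ?X"
      unfolding positive_block_op_def
    proof
      fix v :: "nat \<Rightarrow> 'h"
      define s where "s = (\<Sum>i<n. cinner (v i) (U (fst (p i)) \<psi>))"
      have "cnj s = (\<Sum>j<n. cinner (U (fst (p j)) \<psi>) (v j))"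
        by (simp add: s_def flip: cinner_commute)
      then have "s * cnj s = (\<Sum>i<n. \<Sum>j<n. cinner (v i) (?X i j (v j)))"
        unfolding s_def by (simp add: sum_product ket_bra_def cinner_scaleC_right mult.commute)
      moreover have "0 \<le> s * cnj s"
        unfolding complex_norm_square[symmetric] by (simp add: less_eq_complex_def)
      ultimately show "0 \<le> (\<Sum>i<n. \<Sum>j<n. cinner (v i) (?X i j (v j)))"
        by simp
    qed
    moreover have "completely_positive \<E>"
      using E by (simp add: quantum_channel_def)
    ultimately have "positive_block_op n (\<lambda>i j. \<E> (?X i j))"
      unfolding completely_positive_def by (elim allE[of _ n] allE[of _ ?X]) (simp add: trace_class_ket_bra)
    then have "0 \<le> (\<Sum>i<n. \<Sum>j<n. cinner (\<alpha> i *\<^sub>C snd (p i)) (\<E> (?X i j) (\<alpha> j *\<^sub>C snd (p j))))"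
      unfolding positive_block_op_def by (rule spec)
    also have "\<dots> = (\<Sum>i<n. \<Sum>j<n. cnj (\<alpha> i) * \<alpha> j * F (p i) (p j))"
      by (simp add: F_def T_def[symmetric] clinear_opD[OF T_lin] cinner_scaleC_left cinner_scaleC_right mult_ac)
    finally show "0 \<le> (\<Sum>i<n. \<Sum>j<n. cnj (\<alpha> i) * \<alpha> j * F (p i) (p j))" .
  qed
  \<comment> \<open>Hence \<open>T g h\<close> has no matrix element with \<open>v\<close>
    orthogonal to \<open>U g \<phi>\<close> or \<open>w\<close> orthogonal to
    \<open>U h \<phi>\<close>, and only the number \<open>c g h\<close> survives.\<close>
  have bound: "(cmod (cinner v (T g h w)))\<^sup>2 \<le> (cmod (cinner (U g \<phi>) v))\<^sup>2 * (cmod (cinner (U h \<phi>) w))\<^sup>2"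
    if "g \<in> carrier G" "h \<in> carrier G" for g h v w
  proof -
    have diag: "Re (F (g, v) (g, v)) = (cmod (cinner (U g \<phi>) v))\<^sup>2" if "g \<in> carrier G" for g v
    proof -
      have "cinner v (U g \<phi>) = cnj (cinner (U g \<phi>) v)"
        by (rule cinner_commute)
      then have "F (g, v) (g, v) = complex_of_real ((cmod (cinner (U g \<phi>) v))\<^sup>2)"
        by (simp add: F_def T_diag[OF that] ket_bra_def cinner_scaleC_right flip: complex_norm_square)
      then show ?thesis by simp
    qed
    show ?thesis
      using psd_on_cauchy_schwarz[OF psd, of "(g, v)" "(h, w)"] that
      by (simp add: diag) (simp add: F_def)
  qed
  have norm_U\<phi>: "cinner (U g \<phi>) (U g \<phi>) = 1" if "g \<in> carrier G" for g
    by (simp add: cinner_self unitary_opD(2)[OF unitary[OF that]] \<phi>)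
  define c where "c g h = cinner (U g \<phi>) (T g h (U h \<phi>))" for g h
  have T_rank1: "T g h = ket_bra (c g h *\<^sub>C U g \<phi>) (U h \<phi>)" if gh: "g \<in> carrier G" "h \<in> carrier G" for g h
  proof (rule ext, rule eq_if_cinner_eq)
    fix w v
    have left: "cinner v (T g h w) = cinner v (U g \<phi>) * cinner (U g \<phi>) (T g h w)" for v w
    proof -
      define v' where "v' = v - cinner (U g \<phi>) v *\<^sub>C U g \<phi>"
      have "cinner (U g \<phi>) v' = 0"
        by (simp add: v'_def cinner.diff_right cinner_scaleC_right norm_U\<phi>[OF gh(1)])
      then have "cinner v' (T g h w) = 0"
        using bound[OF gh, of v' w] by simp
      then show ?thesis
        using cinner_commute[of v "U g \<phi>"] by (simp add: v'_def cinner.diff_left cinner_scaleC_left)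
    qed
    have right: "cinner v (T g h w) = cinner (U h \<phi>) w * cinner v (T g h (U h \<phi>))" for v w
    proof -
      define w' where "w' = w - cinner (U h \<phi>) w *\<^sub>C U h \<phi>"
      have "cinner (U h \<phi>) w' = 0"
        by (simp add: w'_def cinner.diff_right cinner_scaleC_right norm_U\<phi>[OF gh(2)])
      then have "cinner v (T g h w') = 0"
        using bound[OF gh, of v w'] by simp
      then show ?thesis
        by (simp add: w'_def clinear_opD[OF T_lin] cinner.diff_right cinner_scaleC_right)
    qed
    show "cinner v (T g h w) = cinner v (ket_bra (c g h *\<^sub>C U g \<phi>) (U h \<phi>) w)"
      using left[of v w] right[of "U g \<phi>" w] by (simp add: ket_bra_def cinner_scaleC_right c_def mult_ac)
  qed
  have trace: "cinner (U h \<psi>) (U g \<psi>) = c g h * cinner (U h \<phi>) (U g \<phi>)"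
    if "g \<in> carrier G" "h \<in> carrier G" for g h
  proof -
    have "trace_op (T g h) = trace_op (ket_bra (U g \<psi>) (U h \<psi>))"
      using E trace_class_ket_bra unfolding T_def quantum_channel_def by blast
    then show ?thesis
      by (simp add: T_rank1[OF that] trace_op_ket_bra cinner_scaleC_right)
  qed
  define f where "f g = c g \<one>" for g
  \<comment> \<open>Translation by \<open>g\<close> carries the pair (inv g h, 1) to (h, g), so by
    covariance \<open>c\<close> depends on the quotient alone. The kernel entry has \<open>h\<close>
    in first place.\<close>
  have f_c: "f (inv g \<otimes> h) = F (h, U h \<phi>) (g, U g \<phi>)" if gh: "g \<in> carrier G" "h \<in> carrier G" for g h
  proof -
    let ?k = "inv g \<otimes> h"
    have k: "?k \<in> carrier G" "g \<otimes> ?k = h"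
      using gh by (simp_all flip: m_assoc)
    have Uh: "U h x = U g (U ?k x)" for x
      using U_mult[OF gh(1) k(1), of x] k(2) by simp
    have "T h g = U g \<circ> T ?k \<one> \<circ> U (inv g)"
      unfolding T_def Uh by (simp add: cov_ket[OF gh(1)] U_one)
    moreover have "U (inv g) (U g \<phi>) = \<phi>"
      using gh by (simp flip: U_mult add: U_one)
    moreover have "cinner (U g x) (U g y) = cinner x y" for x y
      using unitary[OF gh(1)] by (simp add: unitary_op_def)
    ultimately show ?thesis
      by (simp add: F_def f_def c_def Uh U_one)
  qed
  have "positive_definite G f"
    unfolding positive_definite_def
  proof (intro allI impI)
    fix n and g :: "nat \<Rightarrow> 'g" and \<alpha> :: "nat \<Rightarrow> complex"
    assume g: "\<forall>i<n. g i \<in> carrier G"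
    \<comment> \<open>Because \<open>f (inv g \<otimes> h)\<close> is the entry at (h, g), the form
      is taken at the conjugate coefficients and the two sums are exchanged afterwards.\<close>
    have "0 \<le> (\<Sum>j<n. \<Sum>i<n. cnj (cnj (\<alpha> j)) * cnj (\<alpha> i) * F (g j, U (g j) \<phi>) (g i, U (g i) \<phi>))"
      by (rule psd_onD[OF psd]) (use g in auto)
    also have "\<dots> = (\<Sum>i<n. \<Sum>j<n. cnj (\<alpha> i) * \<alpha> j * f (inv (g i) \<otimes> g j))"
      by (subst sum.swap) (use g in \<open>auto intro!: sum.cong simp: f_c\<close>)
    finally show "0 \<le> (\<Sum>i<n. \<Sum>j<n. cnj (\<alpha> i) * \<alpha> j * f (inv (g i) \<otimes> g j))" .
  qed
  moreover have "characteristic_function U \<psi> g = characteristic_function U \<phi> g * f g" if "g \<in> carrier G" for g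
    using trace[OF that one_closed] by (simp add: characteristic_function_def f_def U_one)
  ultimately show ?thesis by blast
qed

subsection \<open>From a positive definite function to a channel\<close>

text \<open>Both unit vectors force f(1) = 1, so the kernel has diagonal 1, and \<open>dense\<close>
  is the density condition of \<open>psd_on_decomposition\<close>.\<close>

lemma cov_convertible_from_positive_definite:
  assumes f: "positive_definite G f"
    and \<chi>: "\<And>g. g \<in> carrier G \<Longrightarrow>
      characteristic_function U \<psi> g = characteristic_function U \<phi> g * f g"
    and norm: "norm \<psi> = 1" "norm \<phi> = 1"
    and C: "countable C" "C \<noteq> {}" "C \<subseteq> carrier G"
    and dense: "\<And>x \<epsilon>. x \<in> carrier G \<Longrightarrow> \<epsilon> > 0 \<Longrightarrow> \<exists>h\<in>C. 2 - 2 * Re (f (inv x \<otimes> h)) < \<epsilon>"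
  shows "cov_convertible G U \<psi> \<phi>"
proof -
  have f1: "f \<one> = 1"
    using \<chi>[OF one_closed] norm by (simp add: characteristic_function_def U_one cinner_self)
  define F where "F x y = f (inv x \<otimes> y)" for x y
  have "psd_on (carrier G) F"
    using f unfolding psd_on_def positive_definite_def F_def .
  moreover have "from_nat_into C n \<in> carrier G" for n
    using from_nat_into[OF C(2)] C(3) by blast
  moreover have "\<exists>i. Re (F x x) + Re (F (from_nat_into C i) (from_nat_into C i))
      - 2 * Re (F x (from_nat_into C i)) < \<epsilon>" if x: "x \<in> carrier G" and \<epsilon>: "\<epsilon> > 0" for x \<epsilon>
  proof -
    obtain h where h: "h \<in> C" "2 - 2 * Re (f (inv x \<otimes> h)) < \<epsilon>"
      using dense[OF x \<epsilon>] by blast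
    then obtain i where "from_nat_into C i = h"
      using from_nat_into_surj[OF C(1)] by blast
    then show ?thesis
      using h x C(3) by (intro exI[of _ i]) (auto simp: F_def f1 subset_iff)
  qed
  ultimately obtain c where c: "\<And>x y. x \<in> carrier G \<Longrightarrow> y \<in> carrier G \<Longrightarrow>
      (\<lambda>k. cnj (c k x) * c k y) sums F x y"
    using psd_on_decomposition[of "carrier G" F "from_nat_into C"] by blast
  define P where "P = (\<lambda>g. U g \<psi>) ` carrier G"
  \<comment> \<open>Coordinate 0 is reserved for the complement of the orbit and the coordinates
    \<open>Suc k\<close> for the orbit itself. Images of the two kinds are thus orthogonal in each
    coordinate, and the channel annihilates the mixed terms.\<close>
  define orbit where "orbit g = (U g \<psi>, \<lambda>k. case k of 0 \<Rightarrow> 0 | Suc k \<Rightarrow> c k g *\<^sub>C U g \<phi>)" for g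
  define rest where "rest q = (q, \<lambda>k. case k of 0 \<Rightarrow> q | Suc k \<Rightarrow> (0::'h))" for q :: 'h
  have ortho_P: "cinner (U g \<psi>) q = 0" "cinner q (U g \<psi>) = 0" if "q \<in> ortho P" "g \<in> carrier G" for q g
    using that cinner_commute[of q "U g \<psi>"] by (auto simp: ortho_def P_def)
  have shift: "s sums S" if "s 0 = 0" "(\<lambda>k. s (Suc k)) sums S" for s :: "nat \<Rightarrow> 'b::real_normed_vector" and S
    using sums_Suc[OF that(2)] that(1) by simp
  have head: "s sums s 0" if "\<And>k. s (Suc k) = 0" for s :: "nat \<Rightarrow> 'b::real_normed_vector"
    using sums_Suc[of s 0] that by simp
  \<comment> \<open>A vector orthogonal to \<open>P\<close> lies in \<open>ortho P\<close>; if it is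
    orthogonal to that set too, it is orthogonal to itself.\<close>
  have total: "ortho (P \<union> ortho P) \<subseteq> {0}"
  proof
    fix y assume y: "y \<in> ortho (P \<union> ortho P)"
    then have "y \<in> ortho P" by (simp add: ortho_def)
    with y have "cinner y y = 0" by (simp add: ortho_def)
    then show "y \<in> {0}" by (simp add: cinner_self)
  qed
  have "\<exists>K. kraus_family K \<and> (\<forall>p\<in>orbit ` carrier G \<union> rest ` ortho P. \<forall>k. K k (fst p) = snd p k)"
  proof (rule kraus_family_from_generators)
    have "fst ` (orbit ` carrier G \<union> rest ` ortho P) = P \<union> ortho P"
      by (simp add: image_Un image_image orbit_def rest_def P_def)
    then show "ortho (fst ` (orbit ` carrier G \<union> rest ` ortho P)) \<subseteq> {0}"
      using total by simp
    have oo: "(\<lambda>k. cinner (snd (orbit g) k) (snd (orbit h) k)) sums cinner (U g \<psi>) (U h \<psi>)"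
      if gh: "g \<in> carrier G" "h \<in> carrier G" for g h
    proof (rule shift)
      have "(\<lambda>k. (cnj (c k g) * c k h) * cinner (U g \<phi>) (U h \<phi>)) sums (F g h * cinner (U g \<phi>) (U h \<phi>))"
        by (intro sums_mult2 c gh)
      \<comment> \<open>The hypothesis on the characteristic functions, at
        \<open>inv g \<otimes> h\<close>, is exactly what isometry on the orbit requires.\<close>
      moreover have "F g h * cinner (U g \<phi>) (U h \<phi>) = cinner (U g \<psi>) (U h \<psi>)"
        using \<chi>[of "inv g \<otimes> h"] gh by (simp add: cinner_U_U F_def characteristic_function_def)
      ultimately show "(\<lambda>k. cinner (snd (orbit g) (Suc k)) (snd (orbit h) (Suc k))) sums cinner (U g \<psi>) (U h \<psi>)"
        by (simp add: orbit_def cinner_scaleC_left cinner_scaleC_right mult_ac)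
    qed (simp add: orbit_def cinner.zero_left)
    have rr: "(\<lambda>k. cinner (snd (rest q) k) (snd (rest q') k)) sums cinner q q'" for q q'
      using head[of "\<lambda>k. cinner (snd (rest q) k) (snd (rest q') k)"] by (simp add: rest_def cinner.zero_left)
    have ort: "(\<lambda>k. cinner (snd (orbit g) k) (snd (rest q) k)) = (\<lambda>k. 0)"
      "(\<lambda>k. cinner (snd (rest q) k) (snd (orbit g) k)) = (\<lambda>k. 0)" for g q
      by (auto simp: orbit_def rest_def cinner.zero_left cinner.zero_right split: nat.splits)
    have fsts: "fst (orbit g) = U g \<psi>" "fst (rest q) = q" for g q
      by (simp_all add: orbit_def rest_def)
    fix p q assume "p \<in> orbit ` carrier G \<union> rest ` ortho P" "q \<in> orbit ` carrier G \<union> rest ` ortho P"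
    then show "(\<lambda>k. cinner (snd p k) (snd q k)) sums cinner (fst p) (fst q)"
      by (auto simp: fsts oo rr ort ortho_P)
  qed
  then obtain K where kf: "kraus_family K"
    and K: "\<And>p k. p \<in> orbit ` carrier G \<union> rest ` ortho P \<Longrightarrow> K k (fst p) = snd p k"
    by blast
  interpret kraus_family K by (rule kf)
  have K_orbit: "K 0 (U g \<psi>) = 0" "K (Suc k) (U g \<psi>) = c k g *\<^sub>C U g \<phi>" if "g \<in> carrier G" for g k
    using K[of "orbit g" 0] K[of "orbit g" "Suc k"] that by (simp_all add: orbit_def)
  have K_rest: "K 0 q = q" "K (Suc k) q = 0" if "q \<in> ortho P" for q k
    using K[of "rest q" 0] K[of "rest q" "Suc k"] that by (simp_all add: rest_def)
  \<comment> \<open>The coefficients enter only through their kernel, at (h, g) because the bra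
    contributes the conjugate factor.\<close>
  have ch_orbit: "channel (ket_bra (U g \<psi>) (U h \<psi>)) v = (F h g * cinner (U h \<phi>) v) *\<^sub>C U g \<phi>"
    if gh: "g \<in> carrier G" "h \<in> carrier G" for g h v
  proof -
    have "(\<lambda>k. cinner (K k (U h \<psi>)) v *\<^sub>C K k (U g \<psi>)) sums ((F h g * cinner (U h \<phi>) v) *\<^sub>C U g \<phi>)"
    proof (rule shift)
      have "(\<lambda>k. (cnj (c k h) * c k g * cinner (U h \<phi>) v) *\<^sub>C U g \<phi>) sums ((F h g * cinner (U h \<phi>) v) *\<^sub>C U g \<phi>)"
        by (intro bounded_linear.sums[OF scaleC.bounded_linear_left] sums_mult2 c gh)
      then show "(\<lambda>k. cinner (K (Suc k) (U h \<psi>)) v *\<^sub>C K (Suc k) (U g \<psi>)) sums ((F h g * cinner (U h \<phi>) v) *\<^sub>C U g \<phi>)"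
        by (simp add: K_orbit gh cinner_scaleC_left scaleC_scaleC mult_ac)
    qed (simp add: K_orbit gh scaleC.zero_right)
    then show ?thesis
      by (rule sums_unique2[OF has_sum_imp_sums[OF channel_ket_bra_has_sum]])
  qed
  have ch_rest: "channel (ket_bra q q') v = cinner q' v *\<^sub>C q" if "q \<in> ortho P" "q' \<in> ortho P" for q q' v
  proof -
    have "(\<lambda>k. cinner (K k q') v *\<^sub>C K k q) sums (cinner q' v *\<^sub>C q)"
      using head[of "\<lambda>k. cinner (K k q') v *\<^sub>C K k q"] by (simp add: K_rest that scaleC.zero_right)
    then show ?thesis
      by (rule sums_unique2[OF has_sum_imp_sums[OF channel_ket_bra_has_sum]])
  qed
  have ch_mixed: "channel (ket_bra (U g \<psi>) q) v = 0" "channel (ket_bra q (U g \<psi>)) v = 0"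
    if "g \<in> carrier G" "q \<in> ortho P" for g q v
  proof -
    have 1: "(\<lambda>k. cinner (K k q) v *\<^sub>C K k (U g \<psi>)) sums 0"
      and 2: "(\<lambda>k. cinner (K k (U g \<psi>)) v *\<^sub>C K k q) sums 0"
      by (rule shift; simp add: K_orbit K_rest that scaleC.zero_right cinner.zero_left)+
    show "channel (ket_bra (U g \<psi>) q) v = 0" "channel (ket_bra q (U g \<psi>)) v = 0"
      using sums_unique2[OF has_sum_imp_sums[OF channel_ket_bra_has_sum] 1]
        sums_unique2[OF has_sum_imp_sums[OF channel_ket_bra_has_sum] 2] by simp_all
  qed
  have U_rest: "U g q \<in> ortho P" if g: "g \<in> carrier G" and q: "q \<in> ortho P" for g q
  proof -
    have "cinner (U h \<psi>) (U g q) = 0" if h: "h \<in> carrier G" for h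
    proof -
      have "cinner (U h \<psi>) (U g q) = cinner (U (inv g \<otimes> h) \<psi>) q"
        using cinner_U_U[of "inv g \<otimes> h" \<one> \<psi> q] cinner_U_U[OF h g, of \<psi> q] g h
        by (simp add: U_one inv_mult_group)
      then show ?thesis using ortho_P(1)[OF q] g h by simp
    qed
    then show ?thesis by (auto simp: ortho_def P_def)
  qed
  have "covariant G U channel"
    unfolding covariant_def
  proof (intro ballI allI impI)
    fix g and X :: "'h \<Rightarrow> 'h"
    assume g: "g \<in> carrier G" and X: "trace_class X"
    note lin = clinear_opD[OF unitary_opD(1)[OF unitary[OF g]]]
    note adj = unitary_opD(4)[OF unitary[OF g], symmetric]
    show "channel (U g \<circ> X \<circ> adjoint_op (U g)) = U g \<circ> channel X \<circ> adjoint_op (U g)"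
    proof (rule covariant_if_covariant_on_total[OF unitary[OF g] total _ X])
      fix p q v assume pq: "p \<in> P \<union> ortho P" "q \<in> P \<union> ortho P"
      show "channel (ket_bra (U g p) (U g q)) v = U g (channel (ket_bra p q) (adjoint_op (U g) v))"
      proof (cases "p \<in> P"; cases "q \<in> P")
        assume "p \<in> P" "q \<in> P"
        then obtain a b where a: "a \<in> carrier G" "p = U a \<psi>" and b: "b \<in> carrier G" "q = U b \<psi>"
          by (auto simp: P_def)
        \<comment> \<open>Left invariance of the kernel is the source of covariance on the
          orbit.\<close>
        have "F (g \<otimes> b) (g \<otimes> a) = F b a"
          using g a b by (simp add: F_def inv_mult_group m_assoc) (simp flip: m_assoc)
        then show ?thesis
          using ch_orbit[of "g \<otimes> a" "g \<otimes> b" v] a b g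
          by (simp add: ch_orbit U_mult lin adj)
      next
        assume "p \<in> P" "q \<notin> P"
        then obtain a where "a \<in> carrier G" "p = U a \<psi>" "q \<in> ortho P"
          using pq by (auto simp: P_def)
        then show ?thesis
          using ch_mixed(1)[of "g \<otimes> a" "U g q" v] g by (simp add: ch_mixed U_rest U_mult lin)
      next
        assume "p \<notin> P" "q \<in> P"
        then obtain b where "b \<in> carrier G" "q = U b \<psi>" "p \<in> ortho P"
          using pq by (auto simp: P_def)
        then show ?thesis
          using ch_mixed(2)[of "g \<otimes> b" "U g p" v] g by (simp add: ch_mixed U_rest U_mult lin)
      next
        assume "p \<notin> P" "q \<notin> P"
        then have "p \<in> ortho P" "q \<in> ortho P" using pq by auto
        then show ?thesis
          by (simp add: ch_rest U_rest[OF g] lin adj)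
      qed
    qed
  qed
  moreover have "channel (ket_bra \<psi> \<psi>) = ket_bra \<phi> \<phi>"
    using ch_orbit[OF one_closed one_closed] by (simp add: fun_eq_iff ket_bra_def U_one F_def f1)
  ultimately show ?thesis
    unfolding cov_convertible_def using quantum_channel by blast
qed

end


text \<open>
  Near the unit \<open>\<chi>\<^sub>\<phi>\<close> does not vanish, so there \<open>f = \<chi>\<^sub>\<psi> / \<chi>\<^sub>\<phi>\<close> is continuous; this is all the
  regularity of \<open>f\<close> that is needed, and in a second countable group it yields a countable set of
  pivots.
\<close>

lemma (in unitary_representation) countable_dense_pivots:
  assumes T: "topspace T = carrier G" "second_countable T"
    and mult: "continuous_map (prod_topology T T) T (\<lambda>(g, h). g \<otimes> h)"
    and cont: "strongly_continuous_rep T U"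
    and \<chi>: "\<And>g. g \<in> carrier G \<Longrightarrow>
      characteristic_function U \<psi> g = characteristic_function U \<phi> g * f g"
    and norm: "norm \<psi> = 1" "norm \<phi> = 1"
  shows "\<exists>C. countable C \<and> C \<noteq> {} \<and> C \<subseteq> carrier G \<and>
    (\<forall>x\<in>carrier G. \<forall>\<epsilon>>0. \<exists>h\<in>C. 2 - 2 * Re (f (inv x \<otimes> h)) < \<epsilon>)"
proof -
  obtain C where C: "countable C" "C \<subseteq> topspace T" "T closure_of C = topspace T"
    using second_countable_imp_separable_space[OF T(2)] unfolding separable_space_def by blast
  have "C \<noteq> {}"
    using C(3) T(1) one_closed by (metis closure_of_empty empty_iff)
  have cont_\<chi>: "continuous_map T euclidean (characteristic_function U v)" for v
  proof -
    have "continuous_map T euclidean (cinner v \<circ> (\<lambda>g. U g v))"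
    proof (rule continuous_map_compose)
      show "continuous_map T euclidean (\<lambda>g. U g v)"
        using cont by (simp add: strongly_continuous_rep_def)
      show "continuous_map euclidean euclidean (cinner v)"
        using linear_continuous_on[OF cinner.bounded_linear_right] by simp
    qed
    then show ?thesis
      by (simp add: characteristic_function_def[abs_def] o_def)
  qed
  have one: "characteristic_function U v \<one> = 1" if "norm v = 1" for v
    using that by (simp add: characteristic_function_def U_one cinner_self)
  have "\<exists>h\<in>C. 2 - 2 * Re (f (inv x \<otimes> h)) < \<epsilon>" if x: "x \<in> carrier G" and \<epsilon>: "\<epsilon> > 0" for x \<epsilon>
  proof -
    define A where "A h = characteristic_function U \<phi> (inv x \<otimes> h)" for h
    define B where "B h = characteristic_function U \<psi> (inv x \<otimes> h)" for h
    \<comment> \<open>Positivity of \<open>d h\<close> says that B h / A h is within \<epsilon> / 2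
      of 1, in a form that stays continuous where \<open>A\<close> vanishes.\<close>
    define d where "d h = \<epsilon> / 2 * cmod (A h) - cmod (B h - A h)" for h
    have "continuous_map T (prod_topology T T) (\<lambda>h. (inv x, h))"
      using x T(1) by (intro continuous_map_pairedI) auto
    from continuous_map_compose[OF this mult]
    have shift: "continuous_map T T (\<lambda>h. inv x \<otimes> h)"
      by (simp add: o_def)
    have "continuous_map T euclidean A" "continuous_map T euclidean B"
      using continuous_map_compose[OF shift cont_\<chi>[of \<phi>]] continuous_map_compose[OF shift cont_\<chi>[of \<psi>]]
      by (simp_all add: A_def[abs_def] B_def[abs_def] o_def)
    then have "continuous_map T euclideanreal d"
      unfolding d_def
      by (intro continuous_map_diff continuous_map_real_mult_left continuous_map_norm)
    define W where "W = {h \<in> topspace T. d h \<in> {0<..}}"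
    have W: "openin T W"
      unfolding W_def using \<open>continuous_map T euclideanreal d\<close> by (rule openin_continuous_map_preimage) simp
    \<comment> \<open>At \<open>x\<close> both characteristic functions are taken at the unit, so
      \<open>d x\<close> equals \<epsilon> / 2.\<close>
    have "x \<in> W"
      using x T(1) \<epsilon> one[OF norm(1)] one[OF norm(2)] by (simp add: W_def d_def A_def B_def)
    moreover have "x \<in> T closure_of C"
      using x C(3) T(1) by simp
    ultimately obtain h where h: "h \<in> C" "h \<in> W"
      using W unfolding in_closure_of by blast
    then have "inv x \<otimes> h \<in> carrier G"
      using x C(2) T(1) by auto
    then have BA: "B h = A h * f (inv x \<otimes> h)"
      unfolding A_def B_def by (rule \<chi>)
    have "cmod (A h) * cmod (f (inv x \<otimes> h) - 1) = cmod (B h - A h)"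
      unfolding BA norm_mult[symmetric] by (simp add: right_diff_distrib)
    also have "\<dots> < cmod (A h) * (\<epsilon> / 2)"
      using h(2) by (simp add: W_def d_def mult.commute)
    finally have "cmod (f (inv x \<otimes> h) - 1) < \<epsilon> / 2"
      by (rule mult_left_less_imp_less) simp
    then have "2 - 2 * Re (f (inv x \<otimes> h)) < \<epsilon>"
      using abs_Re_le_cmod[of "f (inv x \<otimes> h) - 1"] by simp
    then show ?thesis using h(1) by blast
  qed
  then show ?thesis
    using C(1,2) \<open>C \<noteq> {}\<close> T(1) by (intro exI[of _ C]) simp
qed

theorem mainTheorem4:
  fixes G :: "('g, 'm) monoid_scheme"
    and T :: "'g topology"
    and \<A> :: "('g, 'e::euclidean_space) chart set"
    and U :: "'g \<Rightarrow> 'h::complex_hilbert_space \<Rightarrow> 'h"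
    and \<psi> \<phi> :: 'h
  assumes "(group G \<and> finite (carrier G)) \<or>
           (compact_Lie_group G T \<A> \<and> strongly_continuous_rep T U)"
    and "unitary_rep G U"
    and "norm \<psi> = 1" and "norm \<phi> = 1"
  shows "cov_convertible G U \<psi> \<phi> \<longleftrightarrow>
         (\<exists>f :: 'g \<Rightarrow> complex. positive_definite G f \<and>
            (\<forall>g\<in>carrier G.
               characteristic_function U \<psi> g = characteristic_function U \<phi> g * f g))"
proof
  have "group G"
    using assms(1) by (auto simp: compact_Lie_group_def)
  then interpret group G .
  interpret unitary_representation G U
    by unfold_locales (rule assms(2))
  show "\<exists>f. positive_definite G f \<and>
      (\<forall>g\<in>carrier G. characteristic_function U \<psi> g = characteristic_function U \<phi> g * f g)"
    if conv: "cov_convertible G U \<psi> \<phi>"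
  proof -
    obtain \<E> where "quantum_channel \<E>" "covariant G U \<E>" "\<E> (ket_bra \<psi> \<psi>) = ket_bra \<phi> \<phi>"
      using conv unfolding cov_convertible_def by blast
    then show ?thesis
      using assms(4) by (rule positive_definite_from_channel)
  qed
  assume "\<exists>f. positive_definite G f \<and>
    (\<forall>g\<in>carrier G. characteristic_function U \<psi> g = characteristic_function U \<phi> g * f g)"
  then obtain f where f: "positive_definite G f"
    and \<chi>: "\<And>g. g \<in> carrier G \<Longrightarrow> characteristic_function U \<psi> g = characteristic_function U \<phi> g * f g"
    by blast
  have "\<exists>C. countable C \<and> C \<noteq> {} \<and> C \<subseteq> carrier G \<and>
    (\<forall>x\<in>carrier G. \<forall>\<epsilon>>0. \<exists>h\<in>C. 2 - 2 * Re (f (inv\<^bsub>G\<^esub> x \<otimes>\<^bsub>G\<^esub> h)) < \<epsilon>)"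
    using assms(1)
  proof
    \<comment> \<open>A finite carrier is its own countable set of pivots: for h = x the distance is
      2 - 2 Re f(1) = 0.\<close>
    assume "group G \<and> finite (carrier G)"
    then have "finite (carrier G)" by simp
    moreover have "f \<one>\<^bsub>G\<^esub> = 1"
      using \<chi>[OF one_closed] assms(3,4) by (simp add: characteristic_function_def U_one cinner_self)
    then have "\<exists>h\<in>carrier G. 2 - 2 * Re (f (inv\<^bsub>G\<^esub> x \<otimes>\<^bsub>G\<^esub> h)) < \<epsilon>" if "x \<in> carrier G" "\<epsilon> > 0" for x \<epsilon>
      using that by (intro bexI[of _ x]) simp_all
    ultimately show ?thesis
      using one_closed by (intro exI[of _ "carrier G"] conjI countable_finite ballI allI impI) blast+
  next
    assume "compact_Lie_group G T \<A> \<and> strongly_continuous_rep T U"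
    then have "topspace T = carrier G" "second_countable T"
      "continuous_map (prod_topology T T) T (\<lambda>(g, h). g \<otimes>\<^bsub>G\<^esub> h)" "strongly_continuous_rep T U"
      by (simp_all add: compact_Lie_group_def)
    then show ?thesis
      using \<chi> assms(3,4) by (rule countable_dense_pivots)
  qed
  then obtain C where C: "countable C" "C \<noteq> {}" "C \<subseteq> carrier G"
    "\<And>x \<epsilon>. x \<in> carrier G \<Longrightarrow> \<epsilon> > 0 \<Longrightarrow> \<exists>h\<in>C. 2 - 2 * Re (f (inv\<^bsub>G\<^esub> x \<otimes>\<^bsub>G\<^esub> h)) < \<epsilon>"
    by (elim exE conjE) simp
  show "cov_convertible G U \<psi> \<phi>"
    using f \<chi> assms(3,4) C by (rule cov_convertible_from_positive_definite)
qed

end
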